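(* Let $\Bbbk$ be a field of characteristic zero. Let $\mathbf f=c\prod_{i=1}^m(x+\xi_i)\prod_{j=1}^n(y+\chi_j)$ where $c\in\Bbbk^\times$, $(\xi_i)_{i=1}^m$ and $(\chi_j)_{j=1}^n$ are families of distinct scalars in $\Bbbk$, and $m,n\ge3$. Define - $G:=\{\phi\in\mathrm{Aut}_{Poi}(K\{\mathbf f\})\mid\phi(x)\in\Bbbk[x],\;\phi(y)\in\Bbbk[y]\}$; - $m^*:=m-1$ if there is some $s\in\{1,\dots,m\}$ such that $m\xi_s=\sum_{i=1}^m\xi_i$, and $m^*:=m$ otherwise; - $n^*:=n-1$ if there is some $s\in\{1,\dots,n\}$ such that $n\chi_s=\sum_{j=1}^n\chi_j$, and $n^*:=n$ otherwise; - $H:=\{(\gamma,\delta)\in(\Bbbk^\times)^2\mid\gamma^{m^*}=\delta^{n^*}=\gamma^{m-1}\delta^{n-1}=1\}$. Then the following hold. (1) $G$ is a normal subgroup of $\mathrm{Aut}_{Poi}(K\{\mathbf f\})$ with index at most $2$. (2) $G$ is isomorphic to a subgroup of $H$. (3) $\mathrm{Aut}_{Poi}(K\{\mathbf f\})=G$ except possibly when $m=n$ is even and $m^*=n^*=m$, in which case $G$ is cyclic of order at most $m$. (4) $|\mathrm{Aut}_{Poi}(K\{\mathbf f\})|\le(m-1)(n-1)$.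
   Context: For $\mathbf f\in\Bbbk(x,y)$, $K\{\mathbf f\}$ denotes the rational function field $\Bbbk(x,y)$ equipped with the unique ($\Bbbk$-bilinear) Poisson bracket such that $\{x,y\}=\mathbf f$; explicitly $\{g,h\}=\left(\frac{\partial g}{\partial x}\frac{\partial h}{\partial y}-\frac{\partial g}{\partial y}\frac{\partial h}{\partial x}\right)\mathbf f$. $\mathrm{Aut}_{Poi}(K)$ is the group of $\Bbbk$-algebra automorphisms of $K$ preserving the Poisson bracket. *)

theory Defs
  imports
    "HOL-Computational_Algebra.Polynomial"
    "HOL-Computational_Algebra.Fraction_Field"
    "HOL-Algebra.Elementary_Groups"
begin

text \<open>
  The field \<open>k(x,y)\<close> is the fraction field of \<open>k[x][y]\<close>: in
  \<open>'k poly poly\<close> the coefficients are polynomials in \<open>x\<close>, and the outer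
  variable is \<open>y\<close>.
\<close>

type_synonym 'k ratfun = "'k poly poly fract"

definition rconst :: "'k::field_char_0 \<Rightarrow> 'k ratfun" where
  "rconst c = Fract [:[:c:]:] 1"

definition rX :: "'k::field_char_0 ratfun" where
  "rX = Fract [:[:0, 1:]:] 1"

definition rY :: "'k::field_char_0 ratfun" where
  "rY = Fract [:0, 1:] 1"

text \<open>The subalgebra \<open>k[t]\<close> of \<open>k(x,y)\<close> generated by an element \<open>t\<close>.\<close>

definition poly_subalgebra :: "'k::field_char_0 ratfun \<Rightarrow> 'k ratfun set" where
  "poly_subalgebra t = range (\<lambda>p::'k poly. poly (map_poly rconst p) t)"


section \<open>Partial derivatives\<close>

text \<open>On \<open>k[x][y]\<close>, \<open>\<partial>/\<partial>x\<close> is \<open>map_poly pderiv\<close> (coefficientwise) and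
  \<open>\<partial>/\<partial>y\<close> is \<open>pderiv\<close>. Both extend to \<open>k(x,y)\<close> by the quotient rule.\<close>

lemma map_poly_pderiv_add:
  fixes p q :: "'k::field_char_0 poly poly"
  shows "map_poly pderiv (p + q) = map_poly pderiv p + map_poly pderiv q"
  by (rule poly_eqI) (simp add: coeff_map_poly pderiv_add)

lemma map_poly_pderiv_smult:
  fixes p :: "'k::field_char_0 poly poly"
  shows "map_poly pderiv (smult a p) = smult (pderiv a) p + smult a (map_poly pderiv p)"
  by (rule poly_eqI) (simp add: coeff_map_poly pderiv_mult algebra_simps)

lemma map_poly_pderiv_mult:
  fixes p q :: "'k::field_char_0 poly poly"
  shows "map_poly pderiv (p * q) = map_poly pderiv p * q + p * map_poly pderiv q"
  by (induction p)
    (simp_all add: map_poly_pCons map_poly_pderiv_add map_poly_pderiv_smult algebra_simps)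

definition is_derivation :: "('a::idom \<Rightarrow> 'a) \<Rightarrow> bool" where
  "is_derivation D \<longleftrightarrow>
     (\<forall>a b. D (a + b) = D a + D b) \<and> (\<forall>a b. D (a * b) = D a * b + a * D b)"

lemma quotient_rule_respects:
  fixes a b c d a' b' c' d' :: "'a::comm_ring_1"
  assumes "a * d = c * b" and "a' * d + a * d' = c' * b + c * b'"
  shows "(a' * b - a * b') * (d * d) = (c' * d - c * d') * (b * b)"
proof -
  have "(a' * b - a * b') * (d * d) - (c' * d - c * d') * (b * b)
      = (a' * d + a * d' - (c' * b + c * b')) * (b * d) - (a * d - c * b) * (b * d' + b' * d)"
    by (simp add: algebra_simps)
  with assms show ?thesis by simp
qed

text \<open>The extension of a derivation to the fraction field. The value for a \<open>D\<close> that is not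
  a derivation is a dummy: the quotient rule would not be well defined on fractions.\<close>

lift_definition fract_deriv :: "('a::idom \<Rightarrow> 'a) \<Rightarrow> 'a fract \<Rightarrow> 'a fract" is
  "\<lambda>D (a, b). if is_derivation D then (D a * b - a * D b, b * b) else (0, 1)"
proof (clarsimp)
  fix D :: "'a \<Rightarrow> 'a" and a b c d :: 'a
  assume eq: "a * d = c * b" and D: "is_derivation D"
  from arg_cong[OF eq, of D] D have "D a * d + a * D d = D c * b + c * D b"
    by (simp add: is_derivation_def)
  with eq show "(D a * b - a * D b) * (d * d) = (D c * d - c * D d) * (b * b)"
    by (rule quotient_rule_respects)
qed

lemma fract_deriv_Fract:
  "is_derivation D \<Longrightarrow> b \<noteq> 0 \<Longrightarrow>
    fract_deriv D (Fract a b) = Fract (D a * b - a * D b) (b * b)"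
  by transfer simp

definition partial_x :: "'k::field_char_0 ratfun \<Rightarrow> 'k ratfun" where
  "partial_x = fract_deriv (map_poly pderiv)"

definition partial_y :: "'k::field_char_0 ratfun \<Rightarrow> 'k ratfun" where
  "partial_y = fract_deriv pderiv"

lemma partial_x_Fract:
  "b \<noteq> 0 \<Longrightarrow>
    partial_x (Fract a b) = Fract (map_poly pderiv a * b - a * map_poly pderiv b) (b * b)"
  by (simp add: partial_x_def fract_deriv_Fract is_derivation_def
      map_poly_pderiv_add map_poly_pderiv_mult)

lemma partial_y_Fract:
  "b \<noteq> 0 \<Longrightarrow> partial_y (Fract a b) = Fract (pderiv a * b - a * pderiv b) (b * b)"
  by (simp add: partial_y_def fract_deriv_Fract is_derivation_def
      pderiv_add pderiv_mult algebra_simps)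

lemma partial_x_gens [simp]:
  "partial_x (rconst c) = 0" "partial_x rX = 1" "partial_x rY = 0"
  by (simp_all add: rconst_def rX_def rY_def partial_x_Fract map_poly_pCons map_poly_1
      pderiv_pCons
      one_pCons[symmetric] fract_collapse)

lemma partial_y_gens [simp]:
  "partial_y (rconst c) = 0" "partial_y rX = 0" "partial_y rY = 1"
  by (simp_all add: rconst_def rX_def rY_def partial_y_Fract pderiv_pCons
      one_pCons[symmetric] fract_collapse)

lemma partial_x_add: "partial_x (g + h) = partial_x g + partial_x h"
  by (cases g; cases h)
    (simp add: partial_x_Fract eq_fract map_poly_pderiv_add map_poly_pderiv_mult algebra_simps)

lemma partial_x_mult: "partial_x (g * h) = partial_x g * h + g * partial_x h"
  by (cases g; cases h)
    (simp add: partial_x_Fract eq_fract map_poly_pderiv_mult algebra_simps)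

lemma partial_y_add: "partial_y (g + h) = partial_y g + partial_y h"
  by (cases g; cases h)
    (simp add: partial_y_Fract eq_fract pderiv_add pderiv_mult algebra_simps)

lemma partial_y_mult: "partial_y (g * h) = partial_y g * h + g * partial_y h"
  by (cases g; cases h)
    (simp add: partial_y_Fract eq_fract pderiv_mult algebra_simps)


section \<open>The Poisson field \<open>K{f}\<close> and its automorphisms\<close>

definition poisson_bracket ::
  "'k::field_char_0 ratfun \<Rightarrow> 'k ratfun \<Rightarrow> 'k ratfun \<Rightarrow> 'k ratfun" where
  "poisson_bracket f g h =
     (partial_x g * partial_y h - partial_y g * partial_x h) * f"

lemma poisson_bracket_X_Y: "poisson_bracket f rX rY = f"
  by (simp add: poisson_bracket_def)

definition is_poisson_aut ::
  "'k::field_char_0 ratfun \<Rightarrow> ('k ratfun \<Rightarrow> 'k ratfun) \<Rightarrow> bool" where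
  "is_poisson_aut f \<phi> \<longleftrightarrow>
     bij \<phi> \<and>
     (\<forall>g h. \<phi> (g + h) = \<phi> g + \<phi> h) \<and>
     (\<forall>g h. \<phi> (g * h) = \<phi> g * \<phi> h) \<and>
     (\<forall>c. \<phi> (rconst c) = rconst c) \<and>
     (\<forall>g h. \<phi> (poisson_bracket f g h) = poisson_bracket f (\<phi> g) (\<phi> h))"

definition Aut_Poi ::
  "'k::field_char_0 ratfun \<Rightarrow> ('k ratfun \<Rightarrow> 'k ratfun) monoid" where
  "Aut_Poi f =
     \<lparr>carrier = {\<phi>. is_poisson_aut f \<phi>}, mult = (\<lambda>\<phi> \<psi>. \<phi> \<circ> \<psi>), one = id\<rparr>"

lemma is_poisson_aut_inv:
  assumes "is_poisson_aut f \<phi>"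
  shows "is_poisson_aut f (inv_into UNIV \<phi>)"
proof -
  let ?\<psi> = "inv_into UNIV \<phi>"
  have b: "bij \<phi>" using assms by (simp add: is_poisson_aut_def)
  have i: "\<phi> (?\<psi> g) = g" for g using b by (simp add: bij_is_surj surj_f_inv_f)
  have e: "?\<psi> g = h" if "g = \<phi> h" for g h using b that by (simp add: bij_is_inj)
  show ?thesis
    using assms b unfolding is_poisson_aut_def
    by (intro conjI allI) (auto intro!: e simp: i bij_imp_bij_inv)
qed

lemma group_Aut_Poi: "group (Aut_Poi f)"
proof (rule groupI)
  fix \<phi> assume "\<phi> \<in> carrier (Aut_Poi f)"
  then have \<phi>: "is_poisson_aut f \<phi>" by (simp add: Aut_Poi_def)
  then have "inv_into UNIV \<phi> \<circ> \<phi> = id" by (simp add: is_poisson_aut_def bij_is_inj)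
  with is_poisson_aut_inv[OF \<phi>]
  show "\<exists>\<psi>\<in>carrier (Aut_Poi f). \<psi> \<otimes>\<^bsub>Aut_Poi f\<^esub> \<phi> = \<one>\<^bsub>Aut_Poi f\<^esub>"
    by (auto simp: Aut_Poi_def)
qed (auto simp: Aut_Poi_def is_poisson_aut_def bij_comp comp_assoc)

definition Aut_Poi_split ::
  "'k::field_char_0 ratfun \<Rightarrow> ('k ratfun \<Rightarrow> 'k ratfun) set" where
  "Aut_Poi_split f =
     {\<phi> \<in> carrier (Aut_Poi f). \<phi> rX \<in> poly_subalgebra rX \<and> \<phi> rY \<in> poly_subalgebra rY}"


section \<open>The numbers \<open>m\<^sup>*\<close>, \<open>n\<^sup>*\<close> and the group \<open>H\<close>\<close>

definition star_num :: "nat \<Rightarrow> (nat \<Rightarrow> 'k::field_char_0) \<Rightarrow> nat" where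
  "star_num m \<xi> =
     (if \<exists>s\<in>{1..m}. of_nat m * \<xi> s = (\<Sum>i=1..m. \<xi> i) then m - 1 else m)"

definition units_group :: "'k::field_char_0 monoid" where
  "units_group = \<lparr>carrier = UNIV - {0}, mult = (*), one = 1\<rparr>"

text \<open>Below, \<open>ms\<close> and \<open>ns\<close> stand for \<open>m\<^sup>*\<close> and \<open>n\<^sup>*\<close>.\<close>

definition H_group :: "nat \<Rightarrow> nat \<Rightarrow> nat \<Rightarrow> nat \<Rightarrow> ('k::field_char_0 \<times> 'k) monoid" where
  "H_group m n ms ns =
     (units_group \<times>\<times> units_group)
       \<lparr>carrier := {(\<gamma>, \<delta>). \<gamma> \<noteq> 0 \<and> \<delta> \<noteq> 0 \<and>
          \<gamma> ^ ms = 1 \<and> \<delta> ^ ns = 1 \<and> \<gamma> ^ (m - 1) * \<delta> ^ (n - 1) = 1}\<rparr>"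

lemma group_H_group: "group (H_group m n ms ns)" (is "group ?H")
proof (rule groupI)
  fix z assume "z \<in> carrier ?H"
  then show "\<exists>w\<in>carrier ?H. w \<otimes>\<^bsub>?H\<^esub> z = \<one>\<^bsub>?H\<^esub>"
    by (intro bexI[of _ "(inverse (fst z), inverse (snd z))"])
      (auto simp: H_group_def units_group_def DirProd_def power_inverse
        inverse_mult_distrib[symmetric] simp del: inverse_mult_distrib)
next
  fix z w assume "z \<in> carrier ?H" "w \<in> carrier ?H"
  moreover have "(a * a') ^ (m - 1) * (b * b') ^ (n - 1)
      = (a ^ (m - 1) * b ^ (n - 1)) * (a' ^ (m - 1) * b' ^ (n - 1))" for a a' b b' :: 'a
    by (simp add: power_mult_distrib mult_ac)
  ultimately show "z \<otimes>\<^bsub>?H\<^esub> w \<in> carrier ?H"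
    by (auto simp: H_group_def units_group_def DirProd_def power_mult_distrib[of _ _ ms]
        power_mult_distrib[of _ _ ns])
qed (auto simp: H_group_def units_group_def DirProd_def mult_ac)

end

theory Submission
  imports Defs "Berlekamp_Zassenhaus.Unique_Factorization_Poly" "HOL-Algebra.Multiplicative_Group"
begin

text \<open>
  Every prime \<open>h\<close> of \<open>k[x,y]\<close> defines a valuation with
  \<open>\<nu>({u,w}) \<ge> \<nu>(u) + \<nu>(w) - 1\<close>. Applied to \<open>{u,w} = f(u,w)\<close> for \<open>u = \<phi>(x)\<close>, \<open>w = \<phi>(y)\<close>, the
  degrees \<open>m, n \<ge> 3\<close> forbid poles, so a Poisson automorphism \<open>\<phi>\<close> restricts to an automorphism
  of \<open>k[x,y]\<close>. Since \<open>\<phi>(f)\<close> is \<open>f\<close> times the Jacobian, which is a unit, \<open>\<phi>\<close> permutes the linear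
  factors of \<open>f\<close> up to scalars: it is affine in each variable, possibly after swapping \<open>x\<close> and \<open>y\<close>.
  Centring the roots at their mean makes both affine maps linear; comparing products of nonzero roots
  and Jacobians gives the defining equations of \<open>H\<close>. For a swap with scalings \<open>a, a'\<close> the
  product \<open>t = a a'\<close> satisfies \<open>t^(m-1) = -1\<close> and \<open>t^ms = 1\<close>, which forces \<open>ms = m\<close>, \<open>t = -1\<close>
  and \<open>m\<close> even.
\<close>

section \<open>Finite abelian groups and subgroups of index two\<close>

text \<open>The obstacle is to exclude a pole of \<open>u\<close> without knowing how
  \<open>w\<close> behaves along the same prime. A zero of \<open>w\<close>'s product is harmless
  because at most one factor \<open>w + s\<close> vanishes there, and adding a constant to
  \<open>w\<close> does not change the bracket, so \<open>w\<close> may be traded for that factor. A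
  pole of \<open>w\<close> only enlarges the pole of the right-hand side. The threshold 3 makes the
  relative pole order exceed 1; for degree 2 and a simple pole this count gives no contradiction. No
  valuation at infinity is needed: \<open>k[x,y]\<close> is factorial, so an element regular along
  all its primes is already a polynomial. The group theory rests on two characters. Whether an
  automorphism swaps \<open>x\<close> and \<open>y\<close> is a parity with kernel \<open>G\<close>.
  In the exceptional case the scaling factor of \<open>x\<close> alone embeds \<open>G\<close> into
  the multiplicative group of the field, whose finite subgroups are cyclic. There the order bound
  reads \<open>2 m\<close> \<le> \<open>(m-1)^2\<close>, which holds from \<open>m = 4\<close> on;
  evenness excludes \<open>m = 3\<close>.\<close>

text \<open>If \<open>(x y)^n = 1\<close>, raising to the power \<open>ord y\<close> removes
  \<open>y\<close>, so \<open>ord x\<close> divides \<open>n * ord y\<close> and, by coprimality,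
  \<open>n\<close>. The roles of \<open>x\<close> and \<open>y\<close> can be exchanged.\<close>

lemma (in comm_group) ord_mult_coprime:
  assumes x: "x \<in> carrier G" and y: "y \<in> carrier G" and cop: "gcd (ord x) (ord y) = 1"
  shows "ord (x \<otimes> y) = ord x * ord y"
proof -
  have "ord x * ord y dvd n" if eq: "(x \<otimes> y) [^] n = \<one>" for n :: nat
  proof -
    have xy: "x [^] n \<otimes> y [^] n = \<one>"
      using eq x y by (simp add: nat_pow_distrib)
    have dvd: "ord a dvd n"
      if a: "a \<in> carrier G" and b: "b \<in> carrier G" and ab: "a [^] n \<otimes> b [^] n = \<one>"
        and cop: "gcd (ord a) (ord b) = 1" for a b
    proof -
      have "\<one> = (a [^] n \<otimes> b [^] n) [^] ord b"
        using ab by simp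
      also have "\<dots> = a [^] (n * ord b) \<otimes> b [^] (ord b * n)"
        using a b by (simp add: nat_pow_distrib nat_pow_pow mult.commute)
      also have "\<dots> = a [^] (n * ord b) \<otimes> (b [^] ord b) [^] n"
        using nat_pow_pow[OF b, of "ord b" n] by simp
      also have "\<dots> = a [^] (n * ord b)"
        using a b by simp
      finally have "ord a dvd n * ord b"
        by (simp only: pow_eq_id[OF a, symmetric])
      with cop show ?thesis
        using coprime_dvd_mult_left_iff coprime_iff_gcd_eq_1 by blast
    qed
    have "ord x dvd n" "ord y dvd n"
      using dvd[OF x y xy cop] dvd[OF y x] xy x y cop by (simp_all add: m_comm gcd.commute)
    with cop show ?thesis
      by (intro divides_mult) (auto simp: coprime_iff_gcd_eq_1)
  qed
  moreover have "(x \<otimes> y) [^] n = \<one>" if "ord x * ord y dvd n" for n :: nat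
    using that x y abelian_ord_mul_divides[OF x y] by (meson dvd_trans m_closed pow_eq_id)
  ultimately show ?thesis
    using x y by (subst ord_unique) auto
qed

text \<open>An element \<open>a\<close> of maximal order works. If some prime \<open>p\<close> had
  exponent \<open>s\<close> in \<open>ord b\<close> greater than its exponent \<open>r\<close> in
  \<open>ord a\<close>, then the \<open>p\<close>-free part of \<open>a\<close> times the
  \<open>p\<close>-part of \<open>b\<close> would have order larger than \<open>ord a\<close> by the
  factor \<open>p^(s-r)\<close>.\<close>

lemma (in comm_group) exists_exponent_element:
  assumes fin: "finite (carrier G)"
  obtains a where "a \<in> carrier G" "\<And>b. b \<in> carrier G \<Longrightarrow> ord b dvd ord a"
proof -
  have "Max (ord ` carrier G) \<in> ord ` carrier G"
    using fin by (intro Max_in) auto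
  then obtain a where a: "a \<in> carrier G" and Max: "Max (ord ` carrier G) = ord a"
    by auto
  have max: "ord b \<le> ord a" if "b \<in> carrier G" for b
    using fin that by (simp flip: Max)
  have pos: "ord b > 0" if "b \<in> carrier G" for b
    using ord_ge_1[OF fin that] by simp
  have "ord b dvd ord a" if b: "b \<in> carrier G" for b
  proof (rule ccontr)
    assume "\<not> ord b dvd ord a"
    then obtain p where p: "prime p" and lt: "multiplicity p (ord a) < multiplicity p (ord b)"
      using multiplicity_le_imp_dvd[of "ord b" "ord a"] pos[OF b] not_le by blast
    have pp: "p > 0" and p1: "p > 1"
      using prime_gt_0_nat[OF p] prime_gt_1_nat[OF p] .
    define r s where "r = multiplicity p (ord a)" and "s = multiplicity p (ord b)"
    obtain u where u: "ord a = p ^ r * u" "\<not> p dvd u"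
      unfolding r_def
      by (rule multiplicity_decompose'[of "ord a" p]) (use pos[OF a] p1 in auto)
    obtain v where v: "ord b = p ^ s * v" "\<not> p dvd v"
      unfolding s_def
      by (rule multiplicity_decompose'[of "ord b" p]) (use pos[OF b] p1 in auto)
    have "ord (a [^] (p ^ r)) = u"
      using ord_pow[OF a, of "p ^ r"] u pp by simp
    moreover have "ord (b [^] v) = p ^ s"
      using ord_pow[OF b, of v] v pos[OF b] by simp
    moreover have "gcd u (p ^ s) = 1"
      by (rule coprime_imp_gcd_eq_1, rule prime_imp_power_coprime_nat[OF p u(2)])
    ultimately have "ord (a [^] (p ^ r) \<otimes> b [^] v) = u * p ^ s"
      using a b by (subst ord_mult_coprime) auto
    then have "u * p ^ s \<le> u * p ^ r"
      using max[of "a [^] (p ^ r) \<otimes> b [^] v"] a b u by (simp add: mult.commute)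
    moreover have "p ^ r < p ^ s"
      using lt p1 unfolding r_def s_def by (rule power_strict_increasing)
    moreover have "u > 0"
      using u(1) pos[OF a] by (intro gr0I) simp
    ultimately show False
      by simp
  qed
  with a that show ?thesis
    by blast
qed

text \<open>For \<open>a\<close> as in the preceding lemma, every element is a root of
  \<open>x^(ord a) = 1\<close>. There are at most \<open>ord a\<close> of these, and the powers of
  \<open>a\<close> already supply that many.\<close>

lemma (in comm_group) cyclic_groupI_card_roots:
  assumes fin: "finite (carrier G)"
    and card: "\<And>d. d > 0 \<Longrightarrow> card {x \<in> carrier G. x [^] d = \<one>} \<le> (d :: nat)"
  shows "cyclic_group G"
proof -
  obtain a where a: "a \<in> carrier G" and dvd: "\<And>b. b \<in> carrier G \<Longrightarrow> ord b dvd ord a"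
    using exists_exponent_element[OF fin] by blast
  have pos: "ord a > 0"
    using ord_ge_1[OF fin a] by simp
  have "carrier G = {x \<in> carrier G. x [^] ord a = \<one>}"
    using dvd by (auto simp: pow_eq_id)
  then have "card (carrier G) \<le> ord a"
    using card[OF pos] by simp
  moreover have "card (generate G {a}) = ord a"
    using generate_pow_card[OF a] by simp
  moreover have "generate G {a} \<subseteq> carrier G"
    using a by (intro generate_incl) auto
  ultimately have "generate G {a} = carrier G"
    by (intro card_seteq[OF fin]) simp_all
  with generate_pow[OF a] have "carrier G = range (\<lambda>n::int. a [^] n)"
    by auto
  with a show ?thesis
    unfolding cyclic_group by blast
qed

section \<open>Roots of unity in a field\<close>

lemma finite_card_power_eq_1:
  assumes "n > 0"
  shows "finite {x::'a::idom. x ^ n = 1}" and "card {x::'a. x ^ n = 1} \<le> n"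
proof -
  let ?p = "Polynomial.monom (1::'a) n - 1"
  have "poly.coeff ?p n = 1"
    using assms by simp
  then have nz: "?p \<noteq> 0"
    by (metis coeff_0 zero_neq_one)
  have eq: "{x::'a. x ^ n = 1} = {x. poly ?p x = 0}"
    by (simp add: poly_monom)
  have "card {x. poly ?p x = 0} \<le> degree ?p"
    by (rule card_poly_roots_bound[OF nz])
  also have "\<dots> \<le> n"
    by (intro degree_diff_le) (auto simp: degree_monom_le)
  finally show "card {x::'a. x ^ n = 1} \<le> n"
    unfolding eq .
  show "finite {x::'a. x ^ n = 1}"
    unfolding eq by (rule poly_roots_finite[OF nz])
qed

lemma comm_group_units_group: "comm_group (units_group :: 'k::field_char_0 monoid)"
proof (rule comm_groupI)
  fix x :: 'k assume "x \<in> carrier units_group"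
  then show "\<exists>y\<in>carrier units_group. y \<otimes>\<^bsub>units_group\<^esub> x = \<one>\<^bsub>units_group\<^esub>"
    by (intro bexI[of _ "inverse x"]) (auto simp: units_group_def)
qed (auto simp: units_group_def)

lemma nat_pow_units_group:
  "x [^]\<^bsub>units_group\<lparr>carrier := S\<rparr>\<^esub> (d::nat) = (x::'k::field_char_0) ^ d"
  by (induction d) (simp_all add: nat_pow_def units_group_def)

lemma cyclic_group_finite_subgroup_units:
  fixes S :: "'k::field_char_0 set"
  assumes S: "subgroup S units_group" and fin: "finite S"
  shows "cyclic_group (units_group\<lparr>carrier := S\<rparr>)"
proof -
  interpret units: comm_group "units_group :: 'k monoid"
    by (rule comm_group_units_group)
  interpret S: comm_group "units_group\<lparr>carrier := S\<rparr>"
    using units.subgroup_imp_group[OF S]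
    by (rule group.group_comm_groupI) (simp add: units_group_def mult.commute)
  show ?thesis
  proof (rule S.cyclic_groupI_card_roots)
    fix d :: nat assume d: "d > 0"
    have one: "\<one>\<^bsub>units_group\<lparr>carrier := S\<rparr>\<^esub> = (1::'k)"
      by (simp add: units_group_def)
    have "card {x \<in> S. x ^ d = 1} \<le> card {x::'k. x ^ d = 1}"
      by (rule card_mono) (blast intro: finite_card_power_eq_1[OF d])+
    also have "\<dots> \<le> d"
      by (rule finite_card_power_eq_1[OF d])
    finally show "card {x \<in> carrier (units_group\<lparr>carrier := S\<rparr>).
        x [^]\<^bsub>units_group\<lparr>carrier := S\<rparr>\<^esub> d = \<one>\<^bsub>units_group\<lparr>carrier := S\<rparr>\<^esub>} \<le> d"
      by (simp add: nat_pow_units_group one)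
  qed (use fin in simp)
qed

text \<open>The hypothesis makes \<open>P\<close> a homomorphism to the two-element group of truth
  values under equivalence. \<open>K\<close> is its kernel, and the cosets of \<open>K\<close> are
  the level sets of \<open>P\<close>.\<close>

lemma (in group) index_two_of_parity:
  fixes P :: "'a \<Rightarrow> bool"
  assumes P: "\<And>x y. x \<in> carrier G \<Longrightarrow> y \<in> carrier G \<Longrightarrow> P (x \<otimes> y) \<longleftrightarrow> (P x \<longleftrightarrow> P y)"
  defines "K \<equiv> {x \<in> carrier G. P x}"
  shows "K \<lhd> G" and "finite (rcosets K)" and "card (rcosets K) \<le> 2"
    and "finite K \<Longrightarrow> finite (carrier G)"
proof -
  have P1: "P \<one>"
    using P[of \<one> \<one>] by auto
  have Pinv: "P (inv x) \<longleftrightarrow> P x" if "x \<in> carrier G" for x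
    using P[of x "inv x"] P1 that by auto
  have sub: "subgroup K G"
    by unfold_locales (auto simp: K_def P P1 Pinv)
  show "K \<lhd> G"
    unfolding normal_inv_iff using sub by (auto simp: K_def P Pinv)
  have coset: "K #> x = {y \<in> carrier G. P y \<longleftrightarrow> P x}" if x: "x \<in> carrier G" for x
  proof
    show "K #> x \<subseteq> {y \<in> carrier G. P y \<longleftrightarrow> P x}"
      using x by (auto simp: K_def r_coset_def P)
    show "{y \<in> carrier G. P y \<longleftrightarrow> P x} \<subseteq> K #> x"
    proof
      fix y assume "y \<in> {y \<in> carrier G. P y \<longleftrightarrow> P x}"
      then have "y \<otimes> inv x \<in> K" "y = (y \<otimes> inv x) \<otimes> x"
        using x by (auto simp: K_def P Pinv m_assoc)
      then show "y \<in> K #> x"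
        unfolding r_coset_def by blast
    qed
  qed
  have le: "rcosets K \<subseteq> {{y \<in> carrier G. P y}, {y \<in> carrier G. \<not> P y}}"
    by (auto simp: RCOSETS_def coset)
  then show fin: "finite (rcosets K)"
    by (rule finite_subset) simp
  have "card (rcosets K) \<le> card {{y \<in> carrier G. P y}, {y \<in> carrier G. \<not> P y}}"
    using le by (intro card_mono) auto
  also have "\<dots> \<le> 2"
    by (simp add: card_insert_if)
  finally show "card (rcosets K) \<le> 2" .
  show "finite (carrier G)" if "finite K"
  proof -
    have "finite C" if "C \<in> rcosets K" for C
      using that \<open>finite K\<close> by (auto simp: RCOSETS_def r_coset_def)
    then show ?thesis
      using rcosets_part_G[OF sub] fin by (metis finite_Union)
  qed
qed

section \<open>Localizations of \<open>k[x,y]\<close> at primes\<close>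

text \<open>The total degree of the leading monomial for the lexicographic order with
  \<open>y\<close> above \<open>x\<close>. It is additive on products and vanishes only on
  constants, which makes it a measure for inductions that split off prime factors.\<close>

definition bidegree :: "'k::field poly poly \<Rightarrow> nat" where
  "bidegree p = degree p + degree (Polynomial.lead_coeff p)"

lemma bidegree_mult:
  "p \<noteq> 0 \<Longrightarrow> q \<noteq> 0 \<Longrightarrow> bidegree (p * q) = bidegree p + bidegree q"
  unfolding bidegree_def lead_coeff_mult by (simp add: degree_mult_eq)

lemma is_unit_const: "c \<noteq> 0 \<Longrightarrow> [:[:c::'k::field:]:] dvd 1"
  by (simp add: is_unit_const_poly_iff)

lemma bidegree_eq_0:
  assumes "p \<noteq> 0" "bidegree p = 0"
  obtains c where "c \<noteq> 0" "p = [:[:c:]:]"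
proof -
  from assms obtain q where q: "p = [:q:]" "degree q = 0"
    by (auto simp: bidegree_def elim: degree_eq_zeroE)
  then obtain c where "q = [:c:]"
    by (auto elim: degree_eq_zeroE)
  with q assms that show ?thesis
    by auto
qed

lemma bidegree_prime_pos:
  assumes "prime_elem h"
  shows "bidegree (h :: 'k::field poly poly) > 0"
proof (rule ccontr)
  assume "\<not> bidegree h > 0"
  then have "bidegree h = 0"
    by simp
  moreover have "h \<noteq> 0"
    using assms unfolding prime_elem_def by blast
  ultimately obtain c where "c \<noteq> 0" "h = [:[:c:]:]"
    using bidegree_eq_0 by metis
  then have "h dvd 1"
    using is_unit_const by blast
  with assms show False
    unfolding prime_elem_def by blast
qed

section \<open>The valuation ring of a prime, as a subset of the fraction field\<close>

lemma fract_quotient: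
  obtains a b where "u = to_fract a / to_fract b" "b \<noteq> 0"
  using Fract_cases[of u] unfolding Fract_conv_to_fract by metis

text \<open>The condition on \<open>b\<close> also excludes \<open>b = 0\<close>, since
  \<open>h\<close> divides 0; so division by zero never occurs here.\<close>

definition loc :: "'a::idom \<Rightarrow> 'a fract set" where
  "loc h = {to_fract a / to_fract b | a b. \<not> h dvd b}"

definition loc_units :: "'a::idom \<Rightarrow> 'a fract set" where
  "loc_units h = {to_fract a / to_fract b | a b. \<not> h dvd a \<and> \<not> h dvd b}"

lemma locI: "\<not> h dvd b \<Longrightarrow> to_fract a / to_fract b \<in> loc h"
  unfolding loc_def by blast

lemma locE:
  assumes "u \<in> loc h"
  obtains a b where "u = to_fract a / to_fract b" "\<not> h dvd b" "b \<noteq> 0"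
  using assms unfolding loc_def by force

lemma loc_unitsI: "\<not> h dvd a \<Longrightarrow> \<not> h dvd b \<Longrightarrow> to_fract a / to_fract b \<in> loc_units h"
  unfolding loc_units_def by blast

lemma loc_unitsE:
  assumes "u \<in> loc_units h"
  obtains a b where "u = to_fract a / to_fract b" "\<not> h dvd a" "a \<noteq> 0" "\<not> h dvd b" "b \<noteq> 0"
  using assms unfolding loc_units_def by force

lemma loc_units_subset: "u \<in> loc_units h \<Longrightarrow> u \<in> loc h"
  by (auto simp: loc_def loc_units_def)

lemma loc_units_nonzero: "u \<in> loc_units h \<Longrightarrow> u \<noteq> 0"
  by (auto elim: loc_unitsE)

lemma loc_units_inverse: "u \<in> loc_units h \<Longrightarrow> inverse u \<in> loc_units h"
  by (auto elim!: loc_unitsE intro: loc_unitsI)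

lemma loc_nonunit:
  assumes "u \<in> loc h" "u \<notin> loc_units h"
  obtains v where "v \<in> loc h" "u = to_fract h * v"
proof -
  obtain a b where ab: "u = to_fract a / to_fract b" "\<not> h dvd b"
    using assms(1) by (auto elim: locE)
  with assms(2) have "h dvd a"
    by (auto intro: loc_unitsI)
  then obtain c where "a = h * c" ..
  with ab that[of "to_fract c / to_fract b"] show ?thesis
    by (auto intro: locI)
qed

context
  fixes h :: "'a::idom"
  assumes h: "prime_elem h"
begin

lemma to_fract_prime_nonzero: "to_fract h \<noteq> 0"
  using h by auto

lemma loc_to_fract: "to_fract a \<in> loc h"
  using locI[of h 1 a] h by (auto simp: prime_elem_def)

lemma loc_0: "0 \<in> loc h" and loc_1: "1 \<in> loc h"
  using loc_to_fract[of 0] loc_to_fract[of 1] by simp_all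

lemma loc_units_to_fract: "\<not> h dvd a \<Longrightarrow> to_fract a \<in> loc_units h"
  using loc_unitsI[of h a 1] h by (auto simp: prime_elem_def)

lemma loc_add:
  assumes "u \<in> loc h" "v \<in> loc h"
  shows "u + v \<in> loc h"
proof -
  obtain a b where u: "u = to_fract a / to_fract b" "\<not> h dvd b" "b \<noteq> 0"
    using assms(1) by (rule locE)
  obtain c d where v: "v = to_fract c / to_fract d" "\<not> h dvd d" "d \<noteq> 0"
    using assms(2) by (rule locE)
  have "u + v = to_fract (a * d + c * b) / to_fract (b * d)"
    using u v by (simp add: field_simps)
  moreover have "\<not> h dvd b * d"
    using u v h by (simp add: prime_elem_dvd_mult_iff)
  ultimately show ?thesis
    by (simp only: locI not_False_eq_True)
qed

lemma loc_mult:
  assumes "u \<in> loc h" "v \<in> loc h"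
  shows "u * v \<in> loc h"
proof -
  obtain a b where u: "u = to_fract a / to_fract b" "\<not> h dvd b"
    using assms(1) by (rule locE)
  obtain c d where v: "v = to_fract c / to_fract d" "\<not> h dvd d"
    using assms(2) by (rule locE)
  have "u * v = to_fract (a * c) / to_fract (b * d)"
    using u v by simp
  moreover have "\<not> h dvd b * d"
    using u v h by (simp add: prime_elem_dvd_mult_iff)
  ultimately show ?thesis
    by (simp only: locI not_False_eq_True)
qed

lemma loc_uminus: "u \<in> loc h \<Longrightarrow> - u \<in> loc h"
  using loc_mult[OF loc_to_fract[of "-1"]] by simp

lemma loc_diff: "u \<in> loc h \<Longrightarrow> v \<in> loc h \<Longrightarrow> u - v \<in> loc h"
  by (metis loc_add loc_uminus diff_conv_add_uminus)

lemma loc_power: "u \<in> loc h \<Longrightarrow> u ^ n \<in> loc h"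
  by (induction n) (auto intro: loc_mult loc_1)

lemma loc_of_nat: "of_nat n \<in> loc h"
  by (induction n) (auto intro: loc_add loc_0 loc_1)

lemma loc_units_mult:
  assumes "u \<in> loc_units h" "v \<in> loc_units h"
  shows "u * v \<in> loc_units h"
proof -
  obtain a b where u: "u = to_fract a / to_fract b" "\<not> h dvd a" "\<not> h dvd b"
    using assms(1) by (rule loc_unitsE)
  obtain c d where v: "v = to_fract c / to_fract d" "\<not> h dvd c" "\<not> h dvd d"
    using assms(2) by (rule loc_unitsE)
  have "u * v = to_fract (a * c) / to_fract (b * d)"
    using u v by simp
  moreover have "\<not> h dvd b * d" "\<not> h dvd a * c"
    using u v h by (simp_all add: prime_elem_dvd_mult_iff)
  ultimately show ?thesis
    by (simp only: loc_unitsI not_False_eq_True)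
qed

lemma loc_units_prod:
  "(\<And>i. i \<in> I \<Longrightarrow> g i \<in> loc_units h) \<Longrightarrow> (\<Prod>i\<in>I. g i) \<in> loc_units h"
  using loc_units_to_fract[of 1] h
  by (induction I rule: infinite_finite_induct) (auto simp: prime_elem_def loc_units_mult)

lemma loc_units_cancel:
  assumes u: "u \<in> loc_units h" and uv: "u * v \<in> loc h"
  shows "v \<in> loc h"
proof -
  have "inverse u * (u * v) \<in> loc h"
    by (rule loc_mult[OF loc_units_subset[OF loc_units_inverse[OF u]] uv])
  then show ?thesis
    using loc_units_nonzero[OF u] by (simp flip: mult.assoc)
qed

lemma loc_units_1_plus:
  assumes t: "t \<in> loc h"
  shows "1 + to_fract h * t \<in> loc_units h"
proof -
  obtain a b where ab: "t = to_fract a / to_fract b" "\<not> h dvd b" "b \<noteq> 0"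
    using t by (rule locE)
  have "1 + to_fract h * t = to_fract (b + h * a) / to_fract b"
    using ab by (simp add: field_simps)
  moreover have "\<not> h dvd b + h * a"
    using ab(2) by (subst dvd_add_left_iff) simp_all
  ultimately show ?thesis
    using ab by (simp only: loc_unitsI not_False_eq_True)
qed

lemma inverse_prime_notin_loc: "inverse (to_fract h) \<notin> loc h"
proof
  assume "inverse (to_fract h) \<in> loc h"
  then obtain a b where ab: "inverse (to_fract h) = to_fract a / to_fract b" "\<not> h dvd b" "b \<noteq> 0"
    by (rule locE)
  then have "to_fract b = to_fract (h * a)"
    using to_fract_prime_nonzero by (simp add: field_simps)
  then have "b = h * a"
    by (simp only: to_fract_eq_iff)
  with ab show False
    by simp
qed

end

lemma prime_power_factorization:
  fixes a :: "'k::field poly poly"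
  assumes h: "prime_elem h" and "a \<noteq> 0"
  obtains i c where "\<not> h dvd c" "a = h ^ i * c"
  using \<open>a \<noteq> 0\<close>
proof (induction "bidegree a" arbitrary: a thesis rule: less_induct)
  case less
  show ?case
  proof (cases "h dvd a")
    case False
    then show ?thesis
      using less.prems(1)[of a 0] by simp
  next
    case True
    then obtain b where b: "a = h * b" ..
    with less.prems have "b \<noteq> 0" "h \<noteq> 0" by auto
    with b have "bidegree b < bidegree a"
      using bidegree_prime_pos[OF h] by (simp add: bidegree_mult)
    from less.hyps[OF this _ \<open>b \<noteq> 0\<close>] obtain i c where "\<not> h dvd c" "b = h ^ i * c"
      by blast
    then show ?thesis
      using less.prems(1)[of c "Suc i"] b by (simp add: mult.assoc)
  qed
qed

text \<open>The valuation of \<open>u\<close> along \<open>h\<close> is \<open>j - i\<close>. Powers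
  on both sides keep the exponents natural numbers, and no integer-valued valuation has to be
  defined.\<close>

lemma uniformizer_factorization:
  fixes u :: "'k::field poly poly fract"
  assumes h: "prime_elem h" and "u \<noteq> 0"
  obtains i j v where "v \<in> loc_units h" "to_fract h ^ i * u = to_fract h ^ j * v"
proof -
  obtain a b where ab: "u = to_fract a / to_fract b" "b \<noteq> 0"
    by (rule fract_quotient)
  with \<open>u \<noteq> 0\<close> have "a \<noteq> 0"
    by auto
  obtain j a' where a': "\<not> h dvd a'" "a = h ^ j * a'"
    using prime_power_factorization[OF h \<open>a \<noteq> 0\<close>] .
  obtain i b' where b': "\<not> h dvd b'" "b = h ^ i * b'"
    using prime_power_factorization[OF h \<open>b \<noteq> 0\<close>] .
  have pow: "to_fract (h ^ n) = to_fract h ^ n" for n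
    by (induction n) simp_all
  have "to_fract h ^ i * u = to_fract h ^ j * (to_fract a' / to_fract b')"
    using to_fract_prime_nonzero[OF h] unfolding ab(1) a'(2) b'(2) by (simp add: pow)
  moreover have "to_fract a' / to_fract b' \<in> loc_units h"
    using a'(1) b'(1) by (rule loc_unitsI)
  ultimately show ?thesis
    using that by blast
qed

text \<open>A negative valuation means that \<open>1/u\<close> lies in the maximal ideal. The order
  of the pole stays hidden in \<open>t\<close>; the later arguments only use that it is at least
  one.\<close>

lemma notin_loc_pole:
  fixes u :: "'k::field poly poly fract"
  assumes h: "prime_elem h" and u: "u \<notin> loc h"
  obtains t where "t \<in> loc h" "t \<noteq> 0" "u = inverse (to_fract h * t)"
proof -
  let ?H = "to_fract h"
  have H: "?H \<noteq> 0"
    using to_fract_prime_nonzero[OF h] .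
  have "u \<noteq> 0"
    using u loc_0[OF h] by auto
  then obtain i j v where v: "v \<in> loc_units h" and eq: "?H ^ i * u = ?H ^ j * v"
    using uniformizer_factorization[OF h] by blast
  have v0: "v \<noteq> 0"
    using loc_units_nonzero[OF v] .
  have "j < i"
  proof (rule ccontr)
    assume "\<not> j < i"
    then have "?H ^ j = ?H ^ i * ?H ^ (j - i)"
      by (simp flip: power_add)
    with eq H have "u = ?H ^ (j - i) * v"
      by simp
    with u show False
      using loc_mult[OF h loc_power[OF h loc_to_fract[OF h]] loc_units_subset[OF v]] by simp
  qed
  then have "?H ^ i = ?H ^ j * (?H * ?H ^ (i - j - 1))"
    by (simp flip: power_Suc power_add)
  with eq have "?H ^ j * (?H * ?H ^ (i - j - 1) * u) = ?H ^ j * v"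
    by (simp only: mult.assoc)
  then have "?H * ?H ^ (i - j - 1) * u = v"
    using H by (subst (asm) mult_left_cancel) simp_all
  then have "u = inverse (?H * (?H ^ (i - j - 1) * inverse v))"
    using H v0 by (simp add: field_simps)
  moreover have "?H ^ (i - j - 1) * inverse v \<in> loc h" 
    by (rule loc_mult[OF h loc_power[OF h loc_to_fract[OF h]] loc_units_subset[OF loc_units_inverse[OF v]]])
  ultimately show ?thesis
    using that H v0 by auto
qed

text \<open>A prime factor \<open>h\<close> of the denominator \<open>b\<close> can be cancelled:
  comparing \<open>a / b\<close> with a representation whose denominator is prime to
  \<open>h\<close> forces \<open>h\<close> to divide \<open>a\<close>. Each cancellation lowers the
  bidegree of the denominator until it is a unit.\<close>

lemma in_all_loc_imp_polynomial:
  fixes u :: "'k::field poly poly fract"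
  assumes u: "\<And>h. prime_elem h \<Longrightarrow> u \<in> loc h"
  obtains a where "u = to_fract a"
proof -
  obtain a b where "u = to_fract a / to_fract b" "b \<noteq> 0"
    by (rule fract_quotient)
  then have "\<exists>a. u = to_fract a"
  proof (induction "bidegree b" arbitrary: a b rule: less_induct)
    case less
    show ?case
    proof (cases "b dvd 1")
      case True
      then obtain c where c: "1 = b * c" ..
      then have "to_fract b * to_fract c = 1"
        by (simp flip: to_fract_mult)
      then have "to_fract c = inverse (to_fract b)"
        by (metis inverse_unique)
      then have "u = to_fract (a * c)"
        using less.prems by (simp add: divide_inverse)
      then show ?thesis ..
    next
      case False
      then obtain F where F: "mset_factors F b"
        using mset_factors_exist less.prems by blast
      then obtain h where "h \<in># F"
        unfolding mset_factors_def by fastforce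
      with F have "irreducible h" and "h dvd b"
        using mset_factors_imp_dvd[OF F] by (auto simp: mset_factors_def)
      then have h: "prime_elem h"
        by simp
      from \<open>h dvd b\<close> obtain b' where b': "b = h * b'" ..
      obtain c d where cd: "u = to_fract c / to_fract d" "\<not> h dvd d" "d \<noteq> 0"
        using u[OF h] by (rule locE)
      with less.prems have "to_fract (a * d) = to_fract (c * b)"
        by (simp add: field_simps)
      then have "a * d = c * b"
        by (simp only: to_fract_eq_iff)
      then have "h dvd a * d"
        using b' by simp
      then have "h dvd a"
        using cd h by (simp add: prime_elem_dvd_mult_iff)
      then obtain a' where a': "a = h * a'" ..
      have nz: "h \<noteq> 0" "b' \<noteq> 0"
        using b' less.prems by auto
      then have "u = to_fract a' / to_fract b'"
        using less.prems(1) unfolding a' b' by simp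
      moreover have "bidegree b' < bidegree b"
        using nz bidegree_prime_pos[OF h] by (simp add: b' bidegree_mult)
      ultimately show ?thesis
        using less.hyps nz by blast
    qed
  qed
  with that show ?thesis
    by blast
qed

section \<open>Poles of Poisson pairs\<close>

lemma rconst_to_fract: "rconst a = to_fract [:[:a:]:]"
  by (simp add: rconst_def to_fract_def)

lemma rX_to_fract: "rX = to_fract [:[:0, 1:]:]"
  by (simp add: rX_def to_fract_def)

lemma rY_to_fract: "rY = to_fract [:0, 1:]"
  by (simp add: rY_def to_fract_def)

lemma rconst_simps [simp]:
  "rconst 0 = 0" "rconst 1 = 1"
  "rconst (a + b) = rconst a + rconst b" "rconst (a - b) = rconst a - rconst b"
  "rconst (a * b) = rconst a * rconst b" "rconst (- a) = - rconst a"
  unfolding rconst_to_fract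
  by (simp_all flip: to_fract_add to_fract_diff to_fract_mult to_fract_uminus one_pCons
      to_fract_1)

lemma rconst_eq_iff [simp]: "rconst a = rconst b \<longleftrightarrow> a = b"
  by (simp add: rconst_to_fract)

lemma rconst_eq_0_iff [simp]: "rconst a = 0 \<longleftrightarrow> a = 0"
  using rconst_eq_iff[of a 0] by simp

lemma rconst_power: "rconst (a ^ n) = rconst a ^ n"
  by (induction n) simp_all

lemma rconst_loc_units: "prime_elem h \<Longrightarrow> a \<noteq> 0 \<Longrightarrow> rconst a \<in> loc_units h"
  unfolding rconst_to_fract
  using is_unit_const dvd_trans by (intro loc_units_to_fract) (auto simp only: prime_elem_def)

lemma rconst_loc: "prime_elem h \<Longrightarrow> rconst a \<in> loc h"
  by (simp add: rconst_to_fract loc_to_fract)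

lemma partial_x_to_fract: "partial_x (to_fract a) = to_fract (map_poly pderiv a)"
  by (simp add: to_fract_def partial_x_Fract map_poly_1 pderiv_1)

lemma partial_y_to_fract: "partial_y (to_fract a) = to_fract (pderiv a)"
  by (simp add: to_fract_def partial_y_Fract pderiv_1)

text \<open>Differentiating \<open>u * b = a\<close> expresses \<open>b * D u\<close> through
  regular elements, and \<open>b\<close> is a unit along \<open>h\<close>.\<close>

lemma derivation_loc:
  fixes D :: "'a::idom fract \<Rightarrow> 'a fract"
  assumes h: "prime_elem h"
    and mult: "\<And>u v. D (u * v) = D u * v + u * D v"
    and ring: "\<And>a. D (to_fract a) \<in> range to_fract"
    and u: "u \<in> loc h"
  shows "D u \<in> loc h"
proof -
  obtain a b where ab: "u = to_fract a / to_fract b" "\<not> h dvd b" "b \<noteq> 0"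
    using u by (rule locE)
  obtain a' b' where D: "D (to_fract a) = to_fract a'" "D (to_fract b) = to_fract b'"
    using ring[of a] ring[of b] by blast
  have "u * to_fract b = to_fract a"
    using ab by simp
  then have "D u * to_fract b + u * D (to_fract b) = D (to_fract a)"
    by (metis mult)
  then have "to_fract b * D u = to_fract a' - u * to_fract b'"
    by (simp add: D algebra_simps)
  moreover have "to_fract a' - u * to_fract b' \<in> loc h"
    by (intro loc_diff[OF h] loc_mult[OF h] loc_to_fract[OF h] u)
  ultimately show ?thesis
    using loc_units_cancel[OF h loc_units_to_fract[OF h ab(2)]] by simp
qed

lemma partial_x_loc: "prime_elem h \<Longrightarrow> u \<in> loc h \<Longrightarrow> partial_x u \<in> loc h"
  by (rule derivation_loc) (auto simp: partial_x_mult partial_x_to_fract)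

lemma partial_y_loc: "prime_elem h \<Longrightarrow> u \<in> loc h \<Longrightarrow> partial_y u \<in> loc h"
  by (rule derivation_loc) (auto simp: partial_y_mult partial_y_to_fract)

section \<open>Jacobians and their poles along a prime\<close>

definition jac :: "'k::field_char_0 ratfun \<Rightarrow> 'k ratfun \<Rightarrow> 'k ratfun" where
  "jac u v = partial_x u * partial_y v - partial_y u * partial_x v"

lemma poisson_bracket_jac: "poisson_bracket f u v = jac u v * f"
  by (simp add: poisson_bracket_def jac_def)

lemma jac_antisym: "jac v u = - jac u v"
  by (simp add: jac_def algebra_simps)

lemma jac_self [simp]: "jac u u = 0"
  by (simp add: jac_def)

lemma jac_mult_left: "jac (u * w) v = jac u v * w + u * jac w v"
  by (simp add: jac_def partial_x_mult partial_y_mult algebra_simps)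

lemma jac_add_const_right: "jac u (v + rconst a) = jac u v"
  by (simp add: jac_def partial_x_add partial_y_add)

lemma jac_loc: "prime_elem h \<Longrightarrow> u \<in> loc h \<Longrightarrow> v \<in> loc h \<Longrightarrow> jac u v \<in> loc h"
  unfolding jac_def by (intro loc_diff loc_mult partial_x_loc partial_y_loc)

text \<open>The Jacobian for logarithmic differentials \<open>du/u\<close> and \<open>dv/v\<close>.
  It turns products of nonzero elements into sums, so a power of a uniformizer contributes only an
  integer factor.\<close>

definition log_jac :: "'k::field_char_0 ratfun \<Rightarrow> 'k ratfun \<Rightarrow> 'k ratfun" where
  "log_jac u v = jac u v / (u * v)"

lemma log_jac_antisym: "log_jac v u = - log_jac u v"
  unfolding log_jac_def by (subst jac_antisym) (simp add: mult.commute)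

lemma log_jac_self [simp]: "log_jac u u = 0"
  by (simp add: log_jac_def)

lemma mult_1_plus_inverse:
  fixes a b x y :: "'a::comm_ring_1"
  assumes "a * b = 1"
  shows "a * (1 + x * (y * b)) = a + x * y"
proof -
  have "a * (1 + x * (y * b)) = a + x * y * (a * b)"
    by (simp add: algebra_simps)
  with assms show ?thesis
    by simp
qed

lemma divide_mult_add_mult:
  fixes u v w :: "'a::field"
  assumes "u \<noteq> 0" "w \<noteq> 0"
  shows "(a * w + u * b) / (u * w * v) = a / (u * v) + b / (w * v)"
  using assms by (cases "v = 0") (simp_all add: field_simps)

lemma log_jac_mult:
  "u \<noteq> 0 \<Longrightarrow> w \<noteq> 0 \<Longrightarrow> log_jac (u * w) v = log_jac u v + log_jac w v"
  unfolding log_jac_def jac_mult_left by (rule divide_mult_add_mult)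

lemma log_jac_power:
  assumes "u \<noteq> 0" "w \<noteq> 0"
  shows "log_jac (u ^ n * w) v = of_nat n * log_jac u v + log_jac w v"
  using assms
  by (induction n) (simp_all add: log_jac_mult mult.assoc algebra_simps)

lemma log_jac_uniformizer:
  assumes eq: "H ^ i * u = H ^ j * v" and nz: "H \<noteq> 0" "u \<noteq> 0" "v \<noteq> 0"
  shows "log_jac u w = (of_nat j - of_nat i) * log_jac H w + log_jac v w"
proof -
  have "of_nat i * log_jac H w + log_jac u w = of_nat j * log_jac H w + log_jac v w"
    using arg_cong[OF eq, of "\<lambda>z. log_jac z w"] log_jac_power[OF nz(1,2)] log_jac_power[OF nz(1,3)]
    by metis
  then show ?thesis
    by (simp add: algebra_simps)
qed

text \<open>A prime divisor is a 1-valuation: the bracket lowers the valuation by at most one.\<close>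

lemma log_jac_simple_pole:
  fixes u w :: "'k::field_char_0 ratfun"
  assumes h: "prime_elem h" and nz: "u \<noteq> 0" "w \<noteq> 0"
  shows "to_fract h * log_jac u w \<in> loc h"
proof -
  let ?H = "to_fract h :: 'k ratfun"
  have H: "?H \<noteq> 0"
    by (rule to_fract_prime_nonzero[OF h])
  obtain i j v where v: "v \<in> loc_units h" and eq: "?H ^ i * u = ?H ^ j * v"
    using uniformizer_factorization[OF h nz(1)] .
  obtain i' j' v' where v': "v' \<in> loc_units h" and eq': "?H ^ i' * w = ?H ^ j' * v'"
    using uniformizer_factorization[OF h nz(2)] .
  have v0: "v \<noteq> 0" "v' \<noteq> 0"
    using v v' by (simp_all add: loc_units_nonzero)
  define s s' :: "'k ratfun" where "s = of_nat j - of_nat i" and "s' = of_nat j' - of_nat i'"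
  have s: "s \<in> loc h" "s' \<in> loc h"
    unfolding s_def s'_def by (intro loc_diff[OF h] loc_of_nat[OF h])+
  have u: "log_jac u z = s * log_jac ?H z + log_jac v z" for z
    unfolding s_def using log_jac_uniformizer[OF eq H nz(1) v0(1)] .
  have w: "log_jac w z = s' * log_jac ?H z + log_jac v' z" for z
    unfolding s'_def using log_jac_uniformizer[OF eq' H nz(2) v0(2)] .
  \<comment> \<open>Antisymmetry moves the expansion to the second argument. The mixed term
    \<open>s * s' * log_jac H H\<close>, the only one with \<open>H\<close> twice in its
    denominator, is zero; hence a single factor \<open>H\<close> clears all poles.\<close>
  have "log_jac z w = s' * log_jac z ?H + log_jac z v'" for z
    using w[of z] by (simp add: log_jac_antisym[of z])
  then have "log_jac u w = s * log_jac ?H v' + (s' * log_jac v ?H + log_jac v v')"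
    using u[of w] by simp
  also have "?H * \<dots> = s * (jac ?H v' * inverse v') + s' * (jac v ?H * inverse v)
      + ?H * (jac v v' * inverse v * inverse v')"
    using H v0 by (simp add: log_jac_def field_simps)
  also have "\<dots> \<in> loc h"
    using v v'
    by (intro loc_add[OF h] loc_mult[OF h] s jac_loc[OF h] loc_to_fract[OF h])
      (auto intro: loc_units_subset loc_units_inverse)
  finally show ?thesis .
qed

text \<open>Each factor is \<open>u * (1 + s / u)\<close>, and \<open>1 / u\<close> lies in the
  maximal ideal, so the second factor is a unit along \<open>h\<close>.\<close>

lemma prod_add_const_pole:
  fixes u :: "'k::field_char_0 ratfun"
  assumes h: "prime_elem h" and t: "t \<in> loc h" "t \<noteq> 0" and u: "u = inverse (to_fract h * t)"
  obtains v where "v \<in> loc_units h" "(\<Prod>s\<in>S. u + rconst s) = u ^ card S * v"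
proof
  let ?g = "\<lambda>s. 1 + to_fract h * (t * rconst s)"
  have "u * (to_fract h * t) = 1"
    unfolding u by (rule left_inverse) (use t to_fract_prime_nonzero[OF h] in simp)
  then have "u + rconst s = u * ?g s" for s
    by (simp add: distrib_left flip: mult.assoc)
  then show "(\<Prod>s\<in>S. u + rconst s) = u ^ card S * (\<Prod>s\<in>S. ?g s)"
    by (simp add: prod.distrib)
  show "(\<Prod>s\<in>S. ?g s) \<in> loc_units h"
    by (intro loc_units_prod[OF h] loc_units_1_plus[OF h] loc_mult[OF h] t rconst_loc[OF h])
qed

text \<open>At most one of the factors has a zero along \<open>h\<close>, since they differ by nonzero constants.\<close>

lemma prod_add_const_regular:
  fixes u :: "'k::field_char_0 ratfun"
  assumes h: "prime_elem h" and u: "u \<in> loc h" and S: "finite S" "S \<noteq> {}"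
  obtains a v where "v \<in> loc_units h" "(\<Prod>s\<in>S. u + rconst s) = (u + rconst a) * v"
proof -
  have "\<exists>a\<in>S. \<forall>s\<in>S - {a}. u + rconst s \<in> loc_units h"
  proof (cases "\<forall>s\<in>S. u + rconst s \<in> loc_units h")
    case True
    with S show ?thesis
      by blast
  next
    case False
    then obtain a where a: "a \<in> S" "u + rconst a \<notin> loc_units h"
      by blast
    then obtain v where v: "v \<in> loc h" "u + rconst a = to_fract h * v"
      using loc_nonunit[OF loc_add[OF h u rconst_loc[OF h]]] by metis
    have "u + rconst s \<in> loc_units h" if s: "s \<in> S - {a}" for s
    proof -
      \<comment> \<open>With \<open>u + a = H * v\<close> the factor becomes
        \<open>d + H * v = d * (1 + H * v / d)\<close>, a nonzero constant times a unit.\<close>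
      define d where "d = s - a"
      have d: "d \<noteq> 0"
        using s by (auto simp: d_def)
      have "rconst d * rconst (inverse d) = 1"
        using d by (metis rconst_simps(2,5) right_inverse)
      then have "rconst d * (1 + to_fract h * (v * rconst (inverse d))) = rconst d + to_fract h * v"
        by (rule mult_1_plus_inverse)
      also have "\<dots> = u + rconst s"
        by (simp add: d_def flip: v(2))
      finally have "u + rconst s = rconst d * (1 + to_fract h * (v * rconst (inverse d)))"
        by (rule sym)
      also have "\<dots> \<in> loc_units h"
        by (intro loc_units_mult[OF h] rconst_loc_units[OF h] d loc_units_1_plus[OF h]
            loc_mult[OF h] v rconst_loc[OF h])
      finally show ?thesis .
    qed
    with a show ?thesis
      by blast
  qed
  then obtain a where a: "a \<in> S" "\<And>s. s \<in> S - {a} \<Longrightarrow> u + rconst s \<in> loc_units h"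
    by blast
  show ?thesis
  proof
    show "(\<Prod>s\<in>S - {a}. u + rconst s) \<in> loc_units h"
      using a(2) by (rule loc_units_prod[OF h])
    show "(\<Prod>s\<in>S. u + rconst s) = (u + rconst a) * (\<Prod>s\<in>S - {a}. u + rconst s)"
      using S(1) a(1) by (rule prod.remove)
  qed
qed

text \<open>A pole of \<open>u\<close> of order \<open>a\<close> along \<open>h\<close> gives the right-hand side a pole of order at least
  \<open>(|S| - 1) a \<ge> 2\<close> relative to \<open>u w\<close> (with \<open>w\<close> replaced by its factor vanishing along \<open>h\<close>, if
  any), whereas the left-hand side has relative pole order at most one.\<close>

lemma poisson_pair_regular:
  fixes u w :: "'k::field_char_0 ratfun"
  assumes h: "prime_elem h" and f: "f \<in> loc h"
    and c: "c \<noteq> 0" and S: "card S \<ge> 3" and T: "finite T" "T \<noteq> {}"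
    and eq: "jac u w * f = rconst c * (\<Prod>s\<in>S. u + rconst s) * (\<Prod>s\<in>T. w + rconst s)"
    and nz: "jac u w * f \<noteq> 0"
  shows "u \<in> loc h"
proof (rule ccontr)
  define m n where "m = card S" and "n = card T"
  have m: "m \<ge> 3"
    using S by (simp add: m_def)
  have n: "n \<ge> 1"
    using T by (simp add: n_def Suc_le_eq card_gt_0_iff)
  let ?H = "to_fract h :: 'k ratfun"
  have H: "?H \<noteq> 0"
    by (rule to_fract_prime_nonzero[OF h])
  assume "u \<notin> loc h"
  then obtain t where t: "t \<in> loc h" "t \<noteq> 0" "u = inverse (?H * t)"
    using notin_loc_pole[OF h] by blast
  then have u: "u \<noteq> 0"
    using H by simp
  obtain U where U: "U \<in> loc_units h" "(\<Prod>s\<in>S. u + rconst s) = u ^ m * U"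
    using prod_add_const_pole[OF h t] unfolding m_def .
  \<comment> \<open>\<open>z\<close> replaces \<open>w\<close>, and the remaining cofactor
    \<open>a\<close> has the regular inverse \<open>b\<close>, by which the equation may be
    multiplied. If \<open>w\<close> is regular, \<open>z\<close> is \<open>w\<close> shifted to the
    one possibly vanishing factor and \<open>a\<close> is a unit. If \<open>w\<close> has a pole,
    \<open>z = w\<close>, and \<open>a\<close> collects the other \<open>n - 1\<close> powers of
    \<open>w\<close>.\<close>
  have "\<exists>z a b. jac u z = jac u w \<and> a * b = 1 \<and> b \<in> loc h \<and>
      rconst c * (\<Prod>s\<in>T. w + rconst s) = z * a"
  proof (cases "w \<in> loc h")
    case True
    obtain x V where V: "V \<in> loc_units h" "(\<Prod>s\<in>T. w + rconst s) = (w + rconst x) * V"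
      using prod_add_const_regular[OF h True T] .
    have "rconst c * V \<in> loc_units h"
      by (intro loc_units_mult[OF h] V rconst_loc_units[OF h] c)
    then have "(rconst c * V) * inverse (rconst c * V) = 1" "inverse (rconst c * V) \<in> loc h"
      using loc_units_nonzero loc_units_inverse loc_units_subset
      by (blast intro: right_inverse)+
    moreover have "rconst c * ((w + rconst x) * V) = (w + rconst x) * (rconst c * V)"
      by (simp only: mult_ac)
    ultimately show ?thesis
      unfolding V(2) using jac_add_const_right by blast
  next
    case False
    then obtain s where s: "s \<in> loc h" "s \<noteq> 0" "w = inverse (?H * s)"
      using notin_loc_pole[OF h] by blast
    obtain V where V: "V \<in> loc_units h" "(\<Prod>s\<in>T. w + rconst s) = w ^ n * V"
      using prod_add_const_pole[OF h s] unfolding n_def .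
    have cV: "rconst c * V \<in> loc_units h"
      by (intro loc_units_mult[OF h] V rconst_loc_units[OF h] c)
    have w: "w * (?H * s) = 1"
      unfolding s(3) by (rule left_inverse) (use s(2) H in simp)
    let ?a = "w ^ (n - 1) * (rconst c * V)" and ?b = "(?H * s) ^ (n - 1) * inverse (rconst c * V)"
    have "?a * ?b = (w * (?H * s)) ^ (n - 1) * ((rconst c * V) * inverse (rconst c * V))"
      by (simp only: power_mult_distrib mult_ac)
    then have "?a * ?b = 1"
      using right_inverse[OF loc_units_nonzero[OF cV]] by (simp only: w power_one mult_1_left)
    moreover have "?b \<in> loc h"
      by (intro loc_mult[OF h] loc_power[OF h] loc_to_fract[OF h] s
          loc_units_subset[OF loc_units_inverse[OF cV]])
    moreover have "rconst c * (w ^ n * V) = w * ?a"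
      using n by (cases n) (simp_all add: mult_ac)
    ultimately show ?thesis
      unfolding V(2) by blast
  qed
  then obtain z a b where z: "jac u z = jac u w" "a * b = 1" "b \<in> loc h"
      "rconst c * (\<Prod>s\<in>T. w + rconst s) = z * a"
    by blast
  have zw: "jac u z * f = u ^ m * U * (z * a)"
    unfolding z(1) eq z(4)[symmetric] U(2) by (simp only: mult_ac)
  have "z \<noteq> 0"
  proof
    assume "z = 0"
    with zw z(1) nz show False
      by simp
  qed
  have "u ^ m = u * u ^ (m - 1)"
    using m by (cases m) simp_all
  with zw have "log_jac u z * f = u ^ (m - 1) * U * a"
    using u \<open>z \<noteq> 0\<close> by (simp add: log_jac_def field_simps)
  then have "?H * log_jac u z * f * b = U * (?H * u ^ (m - 1))"
    using z(2) by (simp add: mult_ac)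
  moreover have "?H * log_jac u z * f * b \<in> loc h"
    by (intro loc_mult[OF h log_jac_simple_pole[OF h u \<open>z \<noteq> 0\<close>]]
        loc_mult[OF h loc_mult[OF h log_jac_simple_pole[OF h u \<open>z \<noteq> 0\<close>]]] z f)
  ultimately have "?H * u ^ (m - 1) \<in> loc h"
    using loc_units_cancel[OF h U(1)] by metis
  \<comment> \<open>The multiplier is chosen to produce \<open>1 / H\<close>: since
    \<open>H * t = 1 / u\<close>, the power \<open>m - 3\<close> reduces \<open>u^(m-1)\<close> to
    \<open>u^2\<close>, and \<open>H * u^2 * t^2 = 1 / H\<close>. The exponent makes sense because
    \<open>m\<close> \<ge> \<open>3\<close>.\<close>
  then have "(?H * u ^ (m - 1)) * ((?H * t) ^ (m - 3) * (t * t)) \<in> loc h"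
    by (rule loc_mult[OF h])
      (rule loc_mult[OF h loc_power[OF h loc_mult[OF h loc_to_fract[OF h] t(1)]]
        loc_mult[OF h t(1) t(1)]])
  moreover have ut: "u * (?H * t) = 1"
    unfolding t(3) by (rule left_inverse) (use t(2) H in simp)
  have "m - 1 = (m - 3) + 2"
    using m by simp
  then have "u ^ (m - 1) * (?H * t) ^ (m - 3) = (u * (?H * t)) ^ (m - 3) * (u * u)"
    by (simp only: power_add power_mult_distrib power2_eq_square mult_ac)
  then have "?H * (u ^ (m - 1) * (?H * t) ^ (m - 3)) * (t * t) = ?H * (u * u * (t * t))"
    unfolding ut by (simp add: mult.assoc)
  ultimately have "?H * (u * u * (t * t)) \<in> loc h"
    by (simp only: mult_ac)
  moreover have "?H * (?H * (u * u * (t * t))) = (u * (?H * t)) * (u * (?H * t))"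
    by (simp only: mult_ac)
  then have "inverse ?H = ?H * (u * u * (t * t))"
    unfolding ut using H by (metis inverse_unique mult_1)
  ultimately show False
    using inverse_prime_notin_loc[OF h] by simp
qed

section \<open>Images of the linear factors\<close>

lemma range_to_fract_closed:
  fixes u v :: "'a::idom fract"
  assumes "u \<in> range to_fract" "v \<in> range to_fract"
  shows "u + v \<in> range to_fract" "u - v \<in> range to_fract" "u * v \<in> range to_fract"
  using assms by (auto simp flip: to_fract_add to_fract_diff to_fract_mult)

lemma to_fract_prod: "to_fract (prod g A) = (\<Prod>x\<in>A. to_fract (g x))"
  by (induction A rule: infinite_finite_induct) auto

lemma jac_to_fract: "jac (to_fract p) (to_fract q) \<in> range to_fract"
  unfolding jac_def partial_x_to_fract partial_y_to_fract
  by (intro range_to_fract_closed rangeI)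

definition linear_x :: "'k::field_char_0 \<Rightarrow> 'k poly poly" where
  "linear_x a = [:[:a, 1:]:]"

definition linear_y :: "'k::field_char_0 \<Rightarrow> 'k poly poly" where
  "linear_y a = [:[:a:], 1:]"

lemma to_fract_linear_x: "to_fract (linear_x a) = rX + rconst a"
  by (simp add: linear_x_def rX_to_fract rconst_to_fract flip: to_fract_add)

lemma to_fract_linear_y: "to_fract (linear_y a) = rY + rconst a"
  by (simp add: linear_y_def rY_to_fract rconst_to_fract flip: to_fract_add)

section \<open>Units and irreducible elements of \<open>k[x,y]\<close>\<close>

lemma bidegree_unit:
  fixes p :: "'k::field poly poly"
  assumes "p dvd 1"
  shows "bidegree p = 0"
proof -
  obtain q where q: "1 = p * q"
    using assms by (elim dvdE)
  then have "p \<noteq> 0" "q \<noteq> 0"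
    by auto
  then have "bidegree p + bidegree q = bidegree (1 :: 'k poly poly)"
    unfolding q by (simp add: bidegree_mult)
  moreover have "bidegree (1 :: 'k poly poly) = 0"
    by (simp add: bidegree_def)
  ultimately show ?thesis
    by simp
qed

lemma unit_is_const:
  fixes p :: "'k::field poly poly"
  assumes "p dvd 1"
  obtains c where "c \<noteq> 0" "p = [:[:c:]:]"
proof -
  have "p \<noteq> 0"
    using assms by auto
  then show ?thesis
    using bidegree_eq_0 bidegree_unit[OF assms] that by blast
qed

lemma irreducible_bidegree_1:
  fixes p :: "'k::field poly poly"
  assumes "p \<noteq> 0" "bidegree p = 1"
  shows "irreducible p"
proof (rule irreducibleI)
  show "\<not> p dvd 1"
    using bidegree_unit[of p] assms by auto
  fix a b assume p: "p = a * b"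
  with assms have "a \<noteq> 0" "b \<noteq> 0"
    by auto
  with assms have "bidegree a = 0 \<or> bidegree b = 0"
    unfolding p by (auto simp: bidegree_mult)
  then show "a dvd 1 \<or> b dvd 1"
    using bidegree_eq_0 is_unit_const \<open>a \<noteq> 0\<close> \<open>b \<noteq> 0\<close> by metis
qed (fact assms)

lemma irreducible_linear: "irreducible (linear_x a)" "irreducible (linear_y a)"
  by (intro irreducible_bidegree_1; simp add: linear_x_def linear_y_def bidegree_def)+

lemma prime_elem_dvd_prodE:
  assumes "prime_elem q" "q dvd prod g A"
  obtains a where "a \<in> A" "q dvd g a"
proof -
  have "\<exists>a\<in>A. q dvd g a"
    using assms(2)
  proof (induction A rule: infinite_finite_induct)
    case (insert x A)
    then have "q dvd g x \<or> q dvd prod g A"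
      using assms(1) by (simp add: prime_elem_dvd_mult_iff)
    with insert.IH show ?case
      by blast
  qed (use assms(1) in \<open>auto simp: prime_elem_def\<close>)
  with that show ?thesis
    by blast
qed

text \<open>The partial derivatives read off the coefficients of \<open>x\<close> and
  \<open>y\<close>; the constants then agree by cancellation.\<close>

lemma linear_relation:
  assumes "rconst a * rX + rconst b * rY + rconst d = rconst a' * rX + rconst b' * rY + rconst d'"
  shows "a = a'" "b = b'" "d = d'"
proof -
  show a: "a = a'"
    using arg_cong[OF assms, of partial_x] by (simp add: partial_x_add partial_x_mult)
  show b: "b = b'"
    using arg_cong[OF assms, of partial_y] by (simp add: partial_y_add partial_y_mult)
  show "d = d'"
    using assms unfolding a b by simp
qed

section \<open>Poisson automorphisms as field automorphisms\<close>

context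
  fixes f :: "'k::field_char_0 ratfun" and \<phi> :: "'k ratfun \<Rightarrow> 'k ratfun"
  assumes aut: "is_poisson_aut f \<phi>"
begin

lemma aut_add: "\<phi> (u + v) = \<phi> u + \<phi> v"
  and aut_mult: "\<phi> (u * v) = \<phi> u * \<phi> v"
  and aut_const: "\<phi> (rconst a) = rconst a"
  and aut_bij: "bij \<phi>"
  and aut_bracket: "\<phi> (poisson_bracket f u v) = poisson_bracket f (\<phi> u) (\<phi> v)"
  using aut by (simp_all add: is_poisson_aut_def)

lemma aut_0: "\<phi> 0 = 0"
  using aut_const[of 0] by simp

lemma aut_1: "\<phi> 1 = 1"
  using aut_const[of 1] by simp

lemma aut_eq_0_iff: "\<phi> u = 0 \<longleftrightarrow> u = 0"
  using aut_0 aut_bij by (metis bij_pointE)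

lemma aut_prod: "\<phi> (prod g A) = (\<Prod>x\<in>A. \<phi> (g x))"
  by (induction A rule: infinite_finite_induct) (simp_all add: aut_1 aut_mult)

lemma aut_inverse:
  obtains \<psi> where "is_poisson_aut f \<psi>" "\<And>u. \<phi> (\<psi> u) = u" "\<And>u. \<psi> (\<phi> u) = u"
  using is_poisson_aut_inv[OF aut] aut_bij
  by (metis bij_inv_eq_iff)

lemma aut_polynomial:
  assumes "\<phi> rX \<in> range to_fract" "\<phi> rY \<in> range to_fract"
  shows "\<phi> (to_fract p) \<in> range to_fract"
proof (induction p)
  case 0
  show ?case
    using aut_0 by (metis rangeI to_fract_0)
next
  case (pCons q p)
  have "\<phi> (to_fract [:q:]) \<in> range to_fract"
  proof (induction q)
    case 0
    show ?case
      using aut_0 by (metis rangeI to_fract_0 pCons_0_0)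
  next
    case (pCons a q)
    have "[:pCons a q:] = [:[:a:]:] + [:[:0, 1:]:] * [:q:]"
      by simp
    then have "to_fract [:pCons a q:] = rconst a + rX * to_fract [:q:]"
      unfolding rconst_to_fract rX_to_fract by (metis to_fract_add to_fract_mult)
    then have "\<phi> (to_fract [:pCons a q:]) = rconst a + \<phi> rX * \<phi> (to_fract [:q:])"
      by (simp only: aut_add aut_mult aut_const)
    also have "\<dots> \<in> range to_fract"
      unfolding rconst_to_fract by (intro range_to_fract_closed rangeI assms pCons.IH)
    finally show ?case .
  qed
  moreover have "pCons q p = [:q:] + [:0, 1:] * p"
    by simp
  then have "to_fract (pCons q p) = to_fract [:q:] + rY * to_fract p"
    unfolding rY_to_fract by (metis to_fract_add to_fract_mult)
  then have "\<phi> (to_fract (pCons q p)) = \<phi> (to_fract [:q:]) + \<phi> rY * \<phi> (to_fract p)"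
    by (simp only: aut_add aut_mult)
  ultimately show ?case
    using pCons.IH assms(2) by (simp only: range_to_fract_closed)
qed

end

lemma aut_eqI:
  fixes \<phi> \<psi> :: "'k::field_char_0 ratfun \<Rightarrow> 'k ratfun"
  assumes \<phi>: "is_poisson_aut f \<phi>" and \<psi>: "is_poisson_aut f \<psi>"
    and X: "\<phi> rX = \<psi> rX" and Y: "\<phi> rY = \<psi> rY"
  shows "\<phi> = \<psi>"
proof
  have const: "\<phi> (to_fract [:q:]) = \<psi> (to_fract [:q:])" for q
  proof (induction q)
    case 0
    show ?case
      by (simp add: aut_0[OF \<phi>] aut_0[OF \<psi>])
  next
    case (pCons a q)
    have "[:pCons a q:] = [:[:a:]:] + [:[:0, 1:]:] * [:q:]"
      by simp
    then have "to_fract [:pCons a q:] = rconst a + rX * to_fract [:q:]"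
      unfolding rconst_to_fract rX_to_fract by (metis to_fract_add to_fract_mult)
    then show ?case
      by (simp only: aut_add[OF \<phi>] aut_mult[OF \<phi>] aut_const[OF \<phi>]
          aut_add[OF \<psi>] aut_mult[OF \<psi>] aut_const[OF \<psi>] X pCons.IH)
  qed
  have poly: "\<phi> (to_fract p) = \<psi> (to_fract p)" for p
  proof (induction p)
    case 0
    show ?case
      by (simp add: aut_0[OF \<phi>] aut_0[OF \<psi>])
  next
    case (pCons q p)
    have "pCons q p = [:q:] + [:0, 1:] * p"
      by simp
    then have "to_fract (pCons q p) = to_fract [:q:] + rY * to_fract p"
      unfolding rY_to_fract by (metis to_fract_add to_fract_mult)
    then show ?case
      by (simp only: aut_add[OF \<phi>] aut_mult[OF \<phi>] aut_add[OF \<psi>] aut_mult[OF \<psi>]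
          Y const pCons.IH)
  qed
  fix u :: "'k ratfun"
  obtain a b where u: "u = to_fract a / to_fract b" "b \<noteq> 0"
    by (rule fract_quotient)
  then have "u * to_fract b = to_fract a"
    by simp
  then have "\<phi> u * \<phi> (to_fract b) = \<psi> u * \<phi> (to_fract b)"
    by (metis aut_mult[OF \<phi>] aut_mult[OF \<psi>] poly)
  moreover have "\<phi> (to_fract b) \<noteq> 0"
    using u by (simp add: aut_eq_0_iff[OF \<phi>])
  ultimately show "\<phi> u = \<psi> u"
    by simp
qed

text \<open>The indexed families are replaced by the sets of their values, so that permuting the
  roots becomes an equation between images of sets. The elements of \<open>S\<close> and
  \<open>T\<close> are the negatives of the roots. The bounds on the cardinalities also make both
  sets finite.\<close>

locale product_bracket =
  fixes c :: "'k::field_char_0" and S T :: "'k set" and f :: "'k ratfun"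
  assumes c: "c \<noteq> 0" and card_S: "card S \<ge> 3" and card_T: "card T \<ge> 3"
    and f_eq: "f = rconst c * (\<Prod>s\<in>S. rX + rconst s) * (\<Prod>t\<in>T. rY + rconst t)"
begin

lemma finite_S: "finite S" and finite_T: "finite T"
  using card_S card_T by (auto intro: card_ge_0_finite)

lemma nonempty: "S \<noteq> {}" "T \<noteq> {}"
  using card_S card_T by auto

definition F :: "'k poly poly" where
  "F = [:[:c:]:] * (\<Prod>s\<in>S. linear_x s) * (\<Prod>t\<in>T. linear_y t)"

lemma f_to_fract: "f = to_fract F"
  unfolding f_eq F_def rconst_to_fract
  by (simp only: to_fract_mult to_fract_prod to_fract_linear_x to_fract_linear_y rconst_to_fract)

lemma linear_nonzero: "linear_x a \<noteq> 0" "linear_y a \<noteq> 0"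
  by (simp_all add: linear_x_def linear_y_def)

lemma F_nonzero: "F \<noteq> 0"
  using finite_S finite_T c unfolding F_def by (simp add: linear_nonzero)

lemma aut_f:
  assumes "is_poisson_aut f \<phi>"
  shows "\<phi> f = jac (\<phi> rX) (\<phi> rY) * f"
    and "\<phi> f = rconst c * (\<Prod>s\<in>S. \<phi> rX + rconst s) * (\<Prod>t\<in>T. \<phi> rY + rconst t)"
    and "\<phi> f \<noteq> 0"
proof -
  show "\<phi> f = jac (\<phi> rX) (\<phi> rY) * f"
    using aut_bracket[OF assms, of rX rY, unfolded poisson_bracket_X_Y]
    by (simp only: poisson_bracket_jac)
  show "\<phi> f = rconst c * (\<Prod>s\<in>S. \<phi> rX + rconst s) * (\<Prod>t\<in>T. \<phi> rY + rconst t)"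
    by (subst f_eq)
      (simp only: aut_mult[OF assms] aut_prod[OF assms] aut_add[OF assms] aut_const[OF assms])
  show "\<phi> f \<noteq> 0"
    using F_nonzero by (simp add: aut_eq_0_iff[OF assms] f_to_fract)
qed

lemma aut_gens_polynomial:
  assumes \<phi>: "is_poisson_aut f \<phi>"
  shows "\<phi> rX \<in> range to_fract" "\<phi> rY \<in> range to_fract"
proof -
  note f = aut_f[OF \<phi>]
  have eq: "jac (\<phi> rX) (\<phi> rY) * f
      = rconst c * (\<Prod>s\<in>S. \<phi> rX + rconst s) * (\<Prod>t\<in>T. \<phi> rY + rconst t)"
    using f(1,2) by simp
  have nz: "jac (\<phi> rX) (\<phi> rY) * f \<noteq> 0"
    using f(1,3) by simp
  \<comment> \<open>Exchanging the arguments of the bracket brings the claim for \<open>y\<close>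
    into the form of the one for \<open>x\<close>; the sign is absorbed into the constant
    \<open>- c\<close>.\<close>
  have eq': "jac (\<phi> rY) (\<phi> rX) * f
      = rconst (- c) * (\<Prod>t\<in>T. \<phi> rY + rconst t) * (\<Prod>s\<in>S. \<phi> rX + rconst s)"
    unfolding jac_antisym[of "\<phi> rY"] minus_mult_left[symmetric] eq
    by (simp add: mult_ac)
  have nz': "jac (\<phi> rY) (\<phi> rX) * f \<noteq> 0"
    using nz unfolding jac_antisym[of "\<phi> rY"] by simp
  have "\<phi> rX \<in> loc h" if h: "prime_elem h" for h
    using poisson_pair_regular[OF h _ c card_S finite_T nonempty(2) eq nz]
    by (simp add: f_to_fract loc_to_fract[OF h])
  then show "\<phi> rX \<in> range to_fract"
    using in_all_loc_imp_polynomial by (metis rangeI)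
  have "\<phi> rY \<in> loc h" if h: "prime_elem h" for h
    using poisson_pair_regular[OF h _ _ card_T finite_S nonempty(1) eq' nz'] c
    by (simp add: f_to_fract loc_to_fract[OF h])
  then show "\<phi> rY \<in> range to_fract"
    using in_all_loc_imp_polynomial by (metis rangeI)
qed

lemma aut_to_fract:
  assumes "is_poisson_aut f \<phi>"
  obtains q where "\<phi> (to_fract p) = to_fract q"
  using aut_polynomial[OF assms aut_gens_polynomial[OF assms], of p] by blast

lemma aut_unit:
  assumes \<phi>: "is_poisson_aut f \<phi>" and eq: "\<phi> (to_fract p) = to_fract q" and p: "p dvd 1"
  shows "q dvd 1"
proof -
  obtain r where r: "1 = p * r"
    using p by (elim dvdE)
  obtain r' where r': "\<phi> (to_fract r) = to_fract r'"
    by (rule aut_to_fract[OF \<phi>])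
  have "to_fract (q * r') = \<phi> (to_fract (p * r))"
    by (simp add: aut_mult[OF \<phi>] eq r')
  then have "to_fract (q * r') = to_fract 1"
    by (simp add: aut_1[OF \<phi>] flip: r)
  then have "1 = q * r'"
    by (simp only: to_fract_eq_iff)
  then show ?thesis
    by (rule dvdI)
qed

text \<open>The inverse automorphism also maps polynomials to polynomials, so a factorization of
  \<open>q\<close> pulls back to one of \<open>p\<close>, and a unit factor there maps to a unit
  factor of \<open>q\<close>.\<close>

lemma aut_irreducible:
  assumes \<phi>: "is_poisson_aut f \<phi>" and eq: "\<phi> (to_fract p) = to_fract q" and p: "irreducible p"
  shows "irreducible q"
proof -
  obtain \<psi> where \<psi>: "is_poisson_aut f \<psi>" "\<And>u. \<phi> (\<psi> u) = u" "\<And>u. \<psi> (\<phi> u) = u"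
    using aut_inverse[OF \<phi>] by blast
  have eq': "\<psi> (to_fract q) = to_fract p"
    using \<psi>(3) eq by metis
  show ?thesis
  proof (rule irreducibleI)
    show "q \<noteq> 0"
    proof
      assume "q = 0"
      with eq aut_eq_0_iff[OF \<phi>] have "p = 0"
        by simp
      with p show False
        by simp
    qed
    show "\<not> q dvd 1"
      using aut_unit[OF \<psi>(1) eq'] p irreducible_not_unit by blast
    fix a b assume q: "q = a * b"
    obtain a' where a': "\<psi> (to_fract a) = to_fract a'"
      by (rule aut_to_fract[OF \<psi>(1)])
    obtain b' where b': "\<psi> (to_fract b) = to_fract b'"
      by (rule aut_to_fract[OF \<psi>(1)])
    have "to_fract p = to_fract (a' * b')"
      using eq' by (simp add: q aut_mult[OF \<psi>(1)] a' b')
    then have "p = a' * b'"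
      by (simp only: to_fract_eq_iff)
    with p have "a' dvd 1 \<or> b' dvd 1"
      by (rule irreducibleD)
    moreover have "\<phi> (to_fract a') = to_fract a" "\<phi> (to_fract b') = to_fract b"
      using \<psi>(2) a' b' by metis+
    ultimately show "a dvd 1 \<or> b dvd 1"
      using aut_unit[OF \<phi>] by blast
  qed
qed

text \<open>Both \<phi> and its inverse multiply \<open>f\<close> by a polynomial Jacobian, say
  \<open>j\<close> and \<open>j'\<close>. Their composition fixes \<open>f\<close>, so
  \<open>j\<close> times the image of \<open>j'\<close> is 1.\<close>

lemma aut_F_associated:
  assumes \<phi>: "is_poisson_aut f \<phi>"
  obtains j where "j dvd 1" "\<phi> f = to_fract (j * F)"
proof -
  obtain \<psi> where \<psi>: "is_poisson_aut f \<psi>" "\<And>u. \<phi> (\<psi> u) = u" "\<And>u. \<psi> (\<phi> u) = u"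
    using aut_inverse[OF \<phi>] by blast
  have ex: "\<exists>j. \<theta> f = to_fract j * f" if "is_poisson_aut f \<theta>" for \<theta>
    using aut_f(1)[OF that] aut_gens_polynomial[OF that] jac_to_fract by (metis imageE)
  obtain j j' where j: "\<phi> f = to_fract j * f" and j': "\<psi> f = to_fract j' * f"
    using ex[OF \<phi>] ex[OF \<psi>(1)] by blast
  obtain i where i: "\<phi> (to_fract j') = to_fract i"
    by (rule aut_to_fract[OF \<phi>])
  have "f = \<phi> (to_fract j' * f)"
    using \<psi>(2)[of f] j' by simp
  also have "\<dots> = to_fract (j * i) * f"
    by (simp add: aut_mult[OF \<phi>] i j)
  finally have "to_fract (j * i) = to_fract 1"
    using F_nonzero by (simp add: f_to_fract)
  then have "1 = j * i"
    by (simp only: to_fract_eq_iff)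
  then have "j dvd 1"
    by (rule dvdI)
  then show ?thesis
    using that j by (simp add: f_to_fract)
qed

definition linear_factors :: "'k ratfun set" where
  "linear_factors = (\<lambda>s. rX + rconst s) ` S \<union> (\<lambda>t. rY + rconst t) ` T"

text \<open>A linear factor \<open>p\<close> of \<open>F\<close> goes to an irreducible
  \<open>q\<close>. As \<phi> changes \<open>F\<close> only by a unit, \<open>q\<close> divides
  \<open>F\<close>, hence a linear factor \<open>l\<close>; since \<open>l\<close> is irreducible,
  the two differ by a constant.\<close>

lemma linear_image:
  assumes \<phi>: "is_poisson_aut f \<phi>" and u: "u \<in> linear_factors"
  obtains a v where "a \<noteq> 0" "v \<in> linear_factors" "\<phi> u = rconst a * v"
proof -
  let ?L = "linear_x ` S \<union> linear_y ` T"
  have L: "linear_factors = to_fract ` ?L"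
    by (simp add: linear_factors_def image_Un image_image to_fract_linear_x to_fract_linear_y)
  with u obtain p where p: "p \<in> ?L" "u = to_fract p"
    by blast
  then have "irreducible p"
    using irreducible_linear by blast
  have "p dvd F"
  proof -
    have "p dvd (\<Prod>s\<in>S. linear_x s) \<or> p dvd (\<Prod>t\<in>T. linear_y t)"
      using p(1) finite_S finite_T by (auto intro: dvd_prodI)
    then show ?thesis
      unfolding F_def using dvd_mult dvd_mult2 by metis
  qed
  then obtain r where r: "F = p * r" ..
  obtain q where q: "\<phi> (to_fract p) = to_fract q"
    by (rule aut_to_fract[OF \<phi>])
  obtain r' where r': "\<phi> (to_fract r) = to_fract r'"
    by (rule aut_to_fract[OF \<phi>])
  have irr: "irreducible q"
    by (rule aut_irreducible[OF \<phi> q \<open>irreducible p\<close>])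
  then have prime: "prime_elem q"
    by simp
  obtain j where j: "j dvd 1" "\<phi> f = to_fract (j * F)"
    by (rule aut_F_associated[OF \<phi>])
  have "\<phi> f = to_fract (q * r')"
    unfolding f_to_fract r by (simp add: aut_mult[OF \<phi>] q r')
  with j(2) have "j * F = q * r'"
    by (simp only: to_fract_eq_iff)
  then have "q dvd j * F"
    by simp
  then have "q dvd F"
    using j(1) by (simp add: dvd_mult_unit_iff')
  moreover have "\<not> q dvd [:[:c:]:]"
    using is_unit_const[OF c] irr irreducible_not_unit dvd_trans by blast
  ultimately have "q dvd (\<Prod>s\<in>S. linear_x s) \<or> q dvd (\<Prod>t\<in>T. linear_y t)"
    by (simp only: F_def prime_elem_dvd_mult_iff[OF prime] simp_thms)
  then have "\<exists>l\<in>?L. q dvd l"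
    using prime_elem_dvd_prodE[OF prime] by (metis UnI1 UnI2 imageI)
  then obtain l where l: "l \<in> ?L" "q dvd l" ..
  from l(2) obtain k where k: "l = q * k" ..
  have "irreducible l"
    using l(1) irreducible_linear by blast
  then have "q dvd 1 \<or> k dvd 1"
    using k by (rule irreducibleD)
  then have "k dvd 1"
    using irr irreducible_not_unit by blast
  then obtain b where b: "b \<noteq> 0" "k = [:[:b:]:]"
    by (rule unit_is_const)
  then have "to_fract l = \<phi> u * rconst b"
    unfolding k p(2) q rconst_to_fract by (simp only: to_fract_mult)
  then have "rconst (inverse b) * to_fract l = \<phi> u * rconst (b * inverse b)"
    by (simp add: mult_ac)
  then have "\<phi> u = rconst (inverse b) * to_fract l"
    using b(1) by simp
  moreover have "to_fract l \<in> linear_factors"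
    unfolding L using l(1) by blast
  ultimately show ?thesis
    using that b(1) by (metis nonzero_imp_inverse_nonzero)
qed

definition split_form where
  "split_form \<phi> a b a' b' \<longleftrightarrow> a \<noteq> 0 \<and> a' \<noteq> 0 \<and>
     \<phi> rX = rconst a * rX + rconst b \<and> \<phi> rY = rconst a' * rY + rconst b'"

definition swap_form where
  "swap_form \<phi> a b a' b' \<longleftrightarrow> a \<noteq> 0 \<and> a' \<noteq> 0 \<and>
     \<phi> rX = rconst a * rY + rconst b \<and> \<phi> rY = rconst a' * rX + rconst b'"

lemma aut_linear_form:
  assumes \<phi>: "is_poisson_aut f \<phi>" and u: "u + rconst s \<in> linear_factors"
  obtains a b where "a \<noteq> 0" "\<phi> u = rconst a * rX + rconst b"
    | a b where "a \<noteq> 0" "\<phi> u = rconst a * rY + rconst b"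
proof -
  obtain a v where a: "a \<noteq> 0" and v: "v \<in> linear_factors" and eq: "\<phi> (u + rconst s) = rconst a * v"
    using linear_image[OF \<phi> u] .
  from v obtain z t where zt: "v = z + rconst t" "z = rX \<or> z = rY"
    unfolding linear_factors_def by blast
  have "\<phi> u + rconst s = rconst a * (z + rconst t)"
    using eq by (simp only: aut_add[OF \<phi>] aut_const[OF \<phi>] zt(1))
  then have "\<phi> u = rconst a * z + rconst (a * t - s)"
    by (simp add: algebra_simps)
  with that a zt(2) show ?thesis
    by blast
qed

text \<open>The images of \<open>x\<close> and \<open>y\<close> cannot be affine in the same
  variable, as their Jacobian would vanish.\<close>

lemma aut_cases:
  assumes \<phi>: "is_poisson_aut f \<phi>"
  obtains a b a' b' where "split_form \<phi> a b a' b'"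
    | a b a' b' where "swap_form \<phi> a b a' b'"
proof -
  obtain s t where "rX + rconst s \<in> linear_factors" "rY + rconst t \<in> linear_factors"
    using nonempty by (auto simp: linear_factors_def)
  moreover have "jac (\<phi> rX) (\<phi> rY) \<noteq> 0"
    using aut_f(1,3)[OF \<phi>] by auto
  ultimately show ?thesis
    using that unfolding split_form_def swap_form_def
    by (elim aut_linear_form[OF \<phi>])
      (auto simp: jac_def partial_x_add partial_x_mult partial_y_add partial_y_mult)
qed

end

section \<open>Affine maps between finite sets of scalars\<close>

definition mean :: "'k::field_char_0 set \<Rightarrow> 'k" where
  "mean S = \<Sum>S / of_nat (card S)"

definition centred :: "'k::field_char_0 set \<Rightarrow> 'k set" where
  "centred S = (\<lambda>s. s - mean S) ` S"

text \<open>This is the starred number of the theorem: centring produces a zero exactly when the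
  mean belongs to the set, and that zero is the element discarded.\<close>

definition star_card :: "'k::field_char_0 set \<Rightarrow> nat" where
  "star_card S = card (centred S - {0})"

lemma finite_centred: "finite S \<Longrightarrow> finite (centred S)"
  by (simp add: centred_def)

lemma card_centred: "card (centred S) = card S"
  unfolding centred_def by (intro card_image) (simp add: inj_on_def)

lemma star_card_eq:
  "finite S \<Longrightarrow> star_card S = (if mean S \<in> S then card S - 1 else card S)"
  by (auto simp: star_card_def card_Diff_singleton_if card_centred finite_centred)
    (auto simp: centred_def)

lemma star_num_eq:
  assumes inj: "inj_on \<xi> {1..m}" and m: "m \<ge> 1"
  shows "star_num m \<xi> = star_card (\<xi> ` {1..m})"
proof -
  have card: "card (\<xi> ` {1..m}) = m"
    using card_image[OF inj] by simp
  have "\<Sum>(\<xi> ` {1..m}) = (\<Sum>i=1..m. \<xi> i)"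
    using sum.reindex[OF inj, of "\<lambda>x. x"] by simp
  then have "of_nat m * \<xi> s = (\<Sum>i=1..m. \<xi> i) \<longleftrightarrow> mean (\<xi> ` {1..m}) = \<xi> s" for s
    using m by (auto simp: mean_def card[simplified] field_simps)
  then show ?thesis
    by (auto simp: star_num_def star_card_eq card[simplified] image_iff)
qed

text \<open>Summing the elements of both sides gives \<open>mean S + b = a * mean T\<close>. So the
  translation is determined by the scaling, and centring removes it.\<close>

lemma affine_image:
  fixes S T :: "'k::field_char_0 set"
  assumes S: "finite S" "S \<noteq> {}" and a: "a \<noteq> 0" and eq: "(\<lambda>s. s + b) ` S = (\<lambda>t. a * t) ` T"
  shows "card S = card T" and "b = a * mean T - mean S"
    and "centred S = (\<lambda>t. a * t) ` centred T"
proof -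
  have inj: "inj_on (\<lambda>s. s + b) S" "inj_on (\<lambda>t. a * t) T"
    using a by (auto simp: inj_on_def)
  show card: "card S = card T"
    using card_image[OF inj(1)] card_image[OF inj(2)] eq by simp
  have N: "of_nat (card S) \<noteq> (0 :: 'k)"
    using S by simp
  have "\<Sum>S + of_nat (card S) * b = (\<Sum>s\<in>S. s + b)"
    by (simp add: sum.distrib)
  also have "\<dots> = (\<Sum>t\<in>T. a * t)"
    using sum.reindex[OF inj(1), of "\<lambda>x. x"] sum.reindex[OF inj(2), of "\<lambda>x. x"] eq by simp
  also have "\<dots> = a * \<Sum>T"
    by (simp add: sum_distrib_left)
  finally have "mean S + b = a * mean T"
    using N by (simp add: mean_def card[symmetric] field_simps)
  then show b: "b = a * mean T - mean S"
    by (simp add: algebra_simps)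
  have "centred S = (\<lambda>z. z - a * mean T) ` ((\<lambda>s. s + b) ` S)"
    unfolding centred_def image_image by (intro image_cong) (simp_all add: b algebra_simps)
  also have "\<dots> = (\<lambda>t. a * t) ` centred T"
    unfolding eq centred_def image_image by (intro image_cong) (simp_all add: algebra_simps)
  finally show "centred S = (\<lambda>t. a * t) ` centred T" .
qed

text \<open>Comparing the products of the nonzero elements of both sides gives the relation
  \<open>a\<^sup>k = 1\<close> for scalings of a set to itself.\<close>

lemma scaled_image:
  fixes S T :: "'k::field_char_0 set"
  assumes S: "finite S" and a: "a \<noteq> 0" and eq: "centred S = (\<lambda>t. a * t) ` centred T"
  shows "star_card S = star_card T"
    and "\<Prod>(centred S - {0}) = a ^ star_card T * \<Prod>(centred T - {0})"
proof -
  have eq': "centred S - {0} = (\<lambda>t. a * t) ` (centred T - {0})"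
    using a unfolding eq by auto
  have inj: "inj_on (\<lambda>t. a * t) (centred T - {0})"
    using a by (auto simp: inj_on_def)
  show "star_card S = star_card T"
    unfolding star_card_def eq' by (rule card_image[OF inj])
  show "\<Prod>(centred S - {0}) = a ^ star_card T * \<Prod>(centred T - {0})"
    unfolding star_card_def eq' prod.reindex[OF inj] by (simp add: prod.distrib)
qed

lemma prod_centred_nonzero: "finite S \<Longrightarrow> \<Prod>(centred S - {0}) \<noteq> 0"
  by (simp add: finite_centred)

lemma prod_affine_image:
  fixes z :: "'k::field_char_0 ratfun"
  assumes a: "a \<noteq> 0" and eq: "(\<lambda>s. s + b) ` S = (\<lambda>t. a * t) ` T"
  shows "(\<Prod>s\<in>S. rconst a * z + rconst b + rconst s) = rconst (a ^ card T) * (\<Prod>t\<in>T. z + rconst t)"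
proof -
  have inj: "inj_on (\<lambda>s. s + b) S" "inj_on (\<lambda>t. a * t) T"
    using a by (auto simp: inj_on_def)
  have "(\<Prod>s\<in>S. rconst a * z + rconst b + rconst s)
      = (\<Prod>x\<in>(\<lambda>s. s + b) ` S. rconst a * z + rconst x)"
    unfolding prod.reindex[OF inj(1)] by (intro prod.cong) (simp_all add: add_ac)
  also have "\<dots> = (\<Prod>t\<in>T. rconst a * (z + rconst t))"
    unfolding eq prod.reindex[OF inj(2)] by (intro prod.cong) (simp_all add: distrib_left)
  also have "\<dots> = rconst (a ^ card T) * (\<Prod>t\<in>T. z + rconst t)"
    by (simp add: prod.distrib rconst_power)
  finally show ?thesis .
qed

section \<open>The Poisson automorphism group\<close>

context product_bracket
begin

text \<open>Comparing coefficients in \<open>a z + (s + b) = d v\<close> forces \<open>v\<close> to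
  involve the same variable as \<open>z\<close>, and \<open>d = a\<close>. Leaving \<open>u\<close>
  and \<open>z\<close> open lets the lemma serve the split and the swapped form alike.\<close>

lemma aut_roots:
  assumes \<phi>: "is_poisson_aut f \<phi>" and a: "a \<noteq> 0"
    and u: "\<And>s. s \<in> U \<Longrightarrow> u + rconst s \<in> linear_factors"
    and z: "z = rX \<and> Z = S \<or> z = rY \<and> Z = T"
    and eq: "\<phi> u = rconst a * z + rconst b"
  shows "(\<lambda>s. s + b) ` U \<subseteq> (\<lambda>t. a * t) ` Z"
proof (rule image_subsetI)
  fix s assume "s \<in> U"
  then obtain d v where d: "d \<noteq> 0" and v: "v \<in> linear_factors"
    and dv: "\<phi> (u + rconst s) = rconst d * v"
    using linear_image[OF \<phi> u] by metis
  have "\<phi> (u + rconst s) = rconst a * z + rconst (s + b)"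
    unfolding aut_add[OF \<phi>] aut_const[OF \<phi>] eq by simp
  then have *: "rconst a * z + rconst (s + b) = rconst d * v"
    by (simp only: dv)
  from v consider t where "t \<in> S" "v = rX + rconst t" | t where "t \<in> T" "v = rY + rconst t"
    unfolding linear_factors_def by blast
  then have "\<exists>t\<in>Z. s + b = a * t"
  proof cases
    case 1
    from z show ?thesis
    proof
      assume "z = rX \<and> Z = S"
      then show ?thesis
        using * 1 linear_relation[of a 0 "s + b" d 0 "d * t"] by (auto simp: distrib_left)
    next
      assume "z = rY \<and> Z = T"
      then show ?thesis
        using * 1 linear_relation[of 0 a "s + b" d 0 "d * t"] a by (auto simp: distrib_left)
    qed
  next
    case 2
    from z show ?thesis
    proof
      assume "z = rX \<and> Z = S"
      then show ?thesis
        using * 2 linear_relation[of a 0 "s + b" 0 d "d * t"] a by (auto simp: distrib_left)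
    next
      assume "z = rY \<and> Z = T"
      then show ?thesis
        using * 2 linear_relation[of 0 a "s + b" 0 d "d * t"] by (auto simp: distrib_left)
    qed
  qed
  then show "s + b \<in> (\<lambda>t. a * t) ` Z"
    by blast
qed

lemma linear_factorsI:
  "s \<in> S \<Longrightarrow> rX + rconst s \<in> linear_factors" "t \<in> T \<Longrightarrow> rY + rconst t \<in> linear_factors"
  by (auto simp: linear_factors_def)

lemma affine_image_eq:
  fixes U Z :: "'k set"
  assumes "(\<lambda>s. s + b) ` U \<subseteq> (\<lambda>t. a * t) ` Z" "finite Z" "card Z \<le> card U"
  shows "(\<lambda>s. s + b) ` U = (\<lambda>t. a * t) ` Z"
proof (rule card_seteq)
  have "card ((\<lambda>t. a * t) ` Z) \<le> card Z"
    using assms(2) by (rule card_image_le)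
  also have "\<dots> \<le> card ((\<lambda>s. s + b) ` U)"
    using assms(3) by (subst card_image) (simp_all add: inj_on_def)
  finally show "card ((\<lambda>t. a * t) ` Z) \<le> card ((\<lambda>s. s + b) ` U)" .
qed (use assms in simp_all)

lemma f_nonzero: "f \<noteq> 0"
  using F_nonzero by (simp add: f_to_fract)

lemma split_form_facts:
  assumes \<phi>: "is_poisson_aut f \<phi>" and split: "split_form \<phi> a b a' b'"
  shows "b = (a - 1) * mean S" "b' = (a' - 1) * mean T"
    and "a ^ star_card S = 1" "a' ^ star_card T = 1"
    and "a ^ (card S - 1) * a' ^ (card T - 1) = 1"
proof -
  have a: "a \<noteq> 0" "a' \<noteq> 0" and X: "\<phi> rX = rconst a * rX + rconst b"
    and Y: "\<phi> rY = rconst a' * rY + rconst b'"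
    using split by (auto simp: split_form_def)
  have S: "(\<lambda>s. s + b) ` S = (\<lambda>s. a * s) ` S"
    using finite_S by (intro affine_image_eq aut_roots[OF \<phi> a(1) _ _ X] linear_factorsI) auto
  have T: "(\<lambda>s. s + b') ` T = (\<lambda>s. a' * s) ` T"
    using finite_T by (intro affine_image_eq aut_roots[OF \<phi> a(2) _ _ Y] linear_factorsI) auto
  note S' = affine_image[OF finite_S nonempty(1) a(1) S]
  note T' = affine_image[OF finite_T nonempty(2) a(2) T]
  show "b = (a - 1) * mean S" "b' = (a' - 1) * mean T"
    using S'(2) T'(2) by (simp_all add: algebra_simps)
  show "a ^ star_card S = 1"
    using scaled_image(2)[OF finite_S a(1) S'(3)] prod_centred_nonzero[OF finite_S] by simp
  show "a' ^ star_card T = 1"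
    using scaled_image(2)[OF finite_T a(2) T'(3)] prod_centred_nonzero[OF finite_T] by simp
  \<comment> \<open>The image of \<open>f\<close> is computed twice: through the Jacobian
    \<open>a * a'\<close>, and factor by factor. Cancelling \<open>a * a'\<close> lowers both
    exponents by one.\<close>
  have "rconst (a * a') * f = \<phi> f"
    unfolding aut_f(1)[OF \<phi>] X Y
    by (simp add: jac_def partial_x_add partial_x_mult partial_y_add partial_y_mult)
  also have "\<dots> = rconst (a ^ card S * a' ^ card T) * f"
    unfolding aut_f(2)[OF \<phi>] X Y prod_affine_image[OF a(1) S] prod_affine_image[OF a(2) T]
    by (simp only: f_eq rconst_simps mult_ac)
  finally have "a * a' = a ^ card S * a' ^ card T"
    using f_nonzero by (metis mult_right_cancel rconst_eq_iff)
  moreover have "a ^ card S = a * a ^ (card S - 1)" "a' ^ card T = a' * a' ^ (card T - 1)"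
    using card_S card_T by (metis One_nat_def Suc_pred card_gt_0_iff finite_S finite_T nonempty power_Suc)+
  moreover have "(a * a') * (a ^ (card S - 1) * a' ^ (card T - 1))
      = (a * a ^ (card S - 1)) * (a' * a' ^ (card T - 1))"
    by (simp only: mult_ac)
  ultimately have "(a * a') * (a ^ (card S - 1) * a' ^ (card T - 1)) = (a * a') * 1"
    by (metis mult_1_right)
  then show "a ^ (card S - 1) * a' ^ (card T - 1) = 1"
    using a by (metis mult_left_cancel no_zero_divisors)
qed

lemma swap_form_facts:
  assumes \<phi>: "is_poisson_aut f \<phi>" and swap: "swap_form \<phi> a b a' b'"
  shows "card S = card T" "even (card S)" "star_card S = card S" "star_card T = card S"
proof -
  have a: "a \<noteq> 0" "a' \<noteq> 0" and X: "\<phi> rX = rconst a * rY + rconst b"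
    and Y: "\<phi> rY = rconst a' * rX + rconst b'"
    using swap by (auto simp: swap_form_def)
  have subS: "(\<lambda>s. s + b) ` S \<subseteq> (\<lambda>s. a * s) ` T"
    by (intro aut_roots[OF \<phi> a(1) _ _ X] linear_factorsI) auto
  have subT: "(\<lambda>s. s + b') ` T \<subseteq> (\<lambda>s. a' * s) ` S"
    by (intro aut_roots[OF \<phi> a(2) _ _ Y] linear_factorsI) auto
  have le: "card U \<le> card Z" if "(\<lambda>s. s + d) ` U \<subseteq> (\<lambda>s. e * s) ` Z" "finite Z" for U Z and d e :: 'k
  proof -
    have "card U = card ((\<lambda>s. s + d) ` U)"
      by (subst card_image) (simp_all add: inj_on_def)
    also have "\<dots> \<le> card ((\<lambda>s. e * s) ` Z)"
      using that by (intro card_mono) simp_all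
    also have "\<dots> \<le> card Z"
      using that(2) by (rule card_image_le)
    finally show ?thesis .
  qed
  show card: "card S = card T"
    using le[OF subS finite_T] le[OF subT finite_S] by simp
  have S: "(\<lambda>s. s + b) ` S = (\<lambda>s. a * s) ` T"
    using card by (intro affine_image_eq[OF subS finite_T]) simp
  have T: "(\<lambda>s. s + b') ` T = (\<lambda>s. a' * s) ` S"
    using card by (intro affine_image_eq[OF subT finite_S]) simp
  note S' = affine_image[OF finite_S nonempty(1) a(1) S]
  note T' = affine_image[OF finite_T nonempty(2) a(2) T]
  define t where "t = a * a'"
  have t0: "t \<noteq> 0"
    using a by (simp add: t_def)
  have star: "star_card S = star_card T"
    using scaled_image(1)[OF finite_S a(1) S'(3)] .
  \<comment> \<open>Centred \<open>S\<close> is \<open>a\<close> times centred \<open>T\<close>,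
    which is \<open>a'\<close> times centred \<open>S\<close>; so \<open>t\<close> scales centred
    \<open>S\<close> to itself.\<close>
  have "\<Prod>(centred S - {0}) = t ^ star_card S * \<Prod>(centred S - {0})"
    using scaled_image(2)[OF finite_S a(1) S'(3)] scaled_image(2)[OF finite_T a(2) T'(3)]
    by (simp add: star t_def power_mult_distrib)
  then have t_star: "t ^ star_card S = 1"
    using prod_centred_nonzero[OF finite_S] by simp
  \<comment> \<open>The minus sign is the determinant of the swap of \<open>x\<close> and
    \<open>y\<close>. It is the only difference from the split case, and it makes
    \<open>t^(m-1)\<close> equal to \<open>-1\<close> instead of 1.\<close>
  have "rconst (- t) * f = \<phi> f"
    unfolding aut_f(1)[OF \<phi>] X Y t_def
    by (simp add: jac_def partial_x_add partial_x_mult partial_y_add partial_y_mult)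
  also have "\<dots> = rconst (t ^ card S) * f"
    unfolding aut_f(2)[OF \<phi>] X Y prod_affine_image[OF a(1) S] prod_affine_image[OF a(2) T]
      t_def power_mult_distrib
    by (simp only: f_eq rconst_simps mult_ac card)
  finally have t_card: "t ^ card S = - t"
    using f_nonzero by (metis mult_right_cancel rconst_eq_iff)
  have Suc: "card S = Suc (card S - 1)"
    using card_S by simp
  have t_pred: "t ^ (card S - 1) = - 1"
  proof -
    have "t * t ^ (card S - 1) = t * (- 1)"
      using t_card Suc by (metis mult_minus1_right power_Suc)
    then show ?thesis
      using t0 by (metis mult_left_cancel)
  qed
  show "star_card S = card S"
  proof (rule ccontr)
    assume "star_card S \<noteq> card S"
    then have "star_card S = card S - 1"
      by (simp add: star_card_eq[OF finite_S] split: if_splits)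
    with t_star t_pred show False
      by simp
  qed
  then show "star_card T = card S"
    using star by simp
  have "t ^ card S = 1"
    using t_star \<open>star_card S = card S\<close> by simp
  with t_card have "t = - 1"
    by (metis minus_minus)
  with \<open>t ^ card S = 1\<close> show "even (card S)"
    by (cases "even (card S)") simp_all
qed

text \<open>One equation that separates the split from the swapped automorphisms; on the
  automorphism group it is the parity whose kernel is \<open>G\<close>.\<close>

definition preserves_x :: "('k ratfun \<Rightarrow> 'k ratfun) \<Rightarrow> bool" where
  "preserves_x \<phi> \<longleftrightarrow> partial_y (\<phi> rX) = 0"

lemma split_form_preserves_x: "split_form \<phi> a b a' b' \<Longrightarrow> preserves_x \<phi>"
  by (simp add: split_form_def preserves_x_def partial_y_add partial_y_mult)

lemma swap_form_not_preserves_x: "swap_form \<phi> a b a' b' \<Longrightarrow> \<not> preserves_x \<phi>"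
  by (simp add: swap_form_def preserves_x_def partial_y_add partial_y_mult)

lemma preserves_x_iff_split:
  assumes "is_poisson_aut f \<phi>"
  shows "preserves_x \<phi> \<longleftrightarrow> (\<exists>a b a' b'. split_form \<phi> a b a' b')"
  using aut_cases[OF assms] split_form_preserves_x swap_form_not_preserves_x by metis

lemma poly_subalgebra_affine: "rconst a * u + rconst b \<in> poly_subalgebra u"
  unfolding poly_subalgebra_def
  by (rule range_eqI[of _ _ "[:b, a:]"]) (simp add: Polynomial.map_poly_pCons mult.commute add.commute)

lemma partial_y_poly_subalgebra_rX:
  fixes u :: "'k ratfun"
  assumes "u \<in> poly_subalgebra rX"
  shows "partial_y u = 0"
proof -
  have "partial_y (poly (map_poly rconst p) rX) = 0" for p :: "'k poly"
  proof (induction p)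
    case 0
    show ?case
      using partial_y_gens(1)[of "0 :: 'k"] by simp
  next
    case (pCons a p)
    then show ?case
      by (simp add: Polynomial.map_poly_pCons partial_y_add partial_y_mult)
  qed
  with assms show ?thesis
    unfolding poly_subalgebra_def by blast
qed

lemma carrier_Aut_Poi: "carrier (Aut_Poi f) = {\<phi>. is_poisson_aut f \<phi>}"
  by (simp add: Aut_Poi_def)

lemma mult_Aut_Poi: "\<phi> \<otimes>\<^bsub>Aut_Poi f\<^esub> \<psi> = \<phi> \<circ> \<psi>"
  by (simp add: Aut_Poi_def)

lemma Aut_Poi_split_eq: "Aut_Poi_split f = {\<phi> \<in> carrier (Aut_Poi f). preserves_x \<phi>}"
proof -
  have "\<phi> rX \<in> poly_subalgebra rX \<and> \<phi> rY \<in> poly_subalgebra rY \<longleftrightarrow> preserves_x \<phi>"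
    if \<phi>: "is_poisson_aut f \<phi>" for \<phi>
  proof
    assume "\<phi> rX \<in> poly_subalgebra rX \<and> \<phi> rY \<in> poly_subalgebra rY"
    then show "preserves_x \<phi>"
      by (simp add: preserves_x_def partial_y_poly_subalgebra_rX)
  next
    assume "preserves_x \<phi>"
    then obtain a b a' b' where "split_form \<phi> a b a' b'"
      using preserves_x_iff_split[OF \<phi>] by blast
    then show "\<phi> rX \<in> poly_subalgebra rX \<and> \<phi> rY \<in> poly_subalgebra rY"
      by (simp add: split_form_def poly_subalgebra_affine)
  qed
  then show ?thesis
    by (auto simp: Aut_Poi_split_def carrier_Aut_Poi)
qed

text \<open>If \<psi> is split, the composite sends \<open>x\<close> to an affine function of
  \<phi>\<open>(x)\<close>; if \<psi> swaps, to one of \<phi>\<open>(y)\<close>. The latter is free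
  of \<open>y\<close> precisely when \<phi> swaps.\<close>

lemma preserves_x_comp:
  assumes \<phi>: "is_poisson_aut f \<phi>" and \<psi>: "is_poisson_aut f \<psi>"
  shows "preserves_x (\<phi> \<circ> \<psi>) \<longleftrightarrow> (preserves_x \<phi> \<longleftrightarrow> preserves_x \<psi>)"
proof -
  have sp: "preserves_x (\<phi> \<circ> \<psi>) \<longleftrightarrow> preserves_x \<phi>" if "split_form \<psi> a b a' b'" for a b a' b'
    using that by (simp add: split_form_def preserves_x_def aut_add[OF \<phi>] aut_mult[OF \<phi>]
        aut_const[OF \<phi>] partial_y_add partial_y_mult)
  have sw: "preserves_x (\<phi> \<circ> \<psi>) \<longleftrightarrow> partial_y (\<phi> rY) = 0" if "swap_form \<psi> a b a' b'" for a b a' b'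
    using that by (simp add: swap_form_def preserves_x_def aut_add[OF \<phi>] aut_mult[OF \<phi>]
        aut_const[OF \<phi>] partial_y_add partial_y_mult)
  have "partial_y (\<phi> rY) = 0 \<longleftrightarrow> \<not> preserves_x \<phi>"
  proof (rule aut_cases[OF \<phi>])
    fix a b a' b' assume "split_form \<phi> a b a' b'"
    then show ?thesis
      using split_form_preserves_x
      by (auto simp: split_form_def partial_y_add partial_y_mult)
  next
    fix a b a' b' assume "swap_form \<phi> a b a' b'"
    then show ?thesis
      using swap_form_not_preserves_x
      by (auto simp: swap_form_def partial_y_add partial_y_mult)
  qed
  with sp sw show ?thesis
    by (metis aut_cases[OF \<psi>] split_form_preserves_x swap_form_not_preserves_x)
qed

text \<open>The derivatives extract the two scalings. They are constants for a split automorphism,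
  and only then does \<open>the_inv\<close> return a meaningful scalar.\<close>

definition coords :: "('k ratfun \<Rightarrow> 'k ratfun) \<Rightarrow> 'k \<times> 'k" where
  "coords \<phi> = (the_inv rconst (partial_x (\<phi> rX)), the_inv rconst (partial_y (\<phi> rY)))"

lemma coords_split_form: "split_form \<phi> a b a' b' \<Longrightarrow> coords \<phi> = (a, a')"
  by (simp add: split_form_def coords_def partial_x_add partial_x_mult partial_y_add
      partial_y_mult the_inv_f_f inj_def)

lemma split_form_comp:
  assumes \<phi>: "is_poisson_aut f \<phi>"
    and "split_form \<phi> a b a' b'" "split_form \<psi> p q p' q'"
  shows "split_form (\<phi> \<circ> \<psi>) (a * p) (p * b + q) (a' * p') (p' * b' + q')"
  using assms(2,3)
  by (simp add: split_form_def aut_add[OF \<phi>] aut_mult[OF \<phi>] aut_const[OF \<phi>] algebra_simps)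

lemma Aut_Poi_splitE:
  assumes "\<phi> \<in> Aut_Poi_split f"
  obtains a a' where "is_poisson_aut f \<phi>" "coords \<phi> = (a, a')"
    "split_form \<phi> a ((a - 1) * mean S) a' ((a' - 1) * mean T)"
proof -
  have \<phi>: "is_poisson_aut f \<phi>"
    using assms by (simp add: Aut_Poi_split_def carrier_Aut_Poi)
  obtain a b a' b' where s: "split_form \<phi> a b a' b'"
    using assms preserves_x_iff_split[OF \<phi>] by (auto simp: Aut_Poi_split_eq)
  show ?thesis
    using that[OF \<phi> coords_split_form[OF s]] s split_form_facts(1,2)[OF \<phi> s] by simp
qed

lemma coords_comp:
  assumes "\<phi> \<in> Aut_Poi_split f" "\<psi> \<in> Aut_Poi_split f"
  shows "coords (\<phi> \<circ> \<psi>) = (fst (coords \<phi>) * fst (coords \<psi>), snd (coords \<phi>) * snd (coords \<psi>))"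
  using assms(1)
proof (rule Aut_Poi_splitE)
  fix a a'
  assume 1: "is_poisson_aut f \<phi>" "coords \<phi> = (a, a')"
    "split_form \<phi> a ((a - 1) * mean S) a' ((a' - 1) * mean T)"
  show ?thesis
    using assms(2)
  proof (rule Aut_Poi_splitE)
    fix p p'
    assume 2: "coords \<psi> = (p, p')" "split_form \<psi> p ((p - 1) * mean S) p' ((p' - 1) * mean T)"
    show ?thesis
      using coords_split_form[OF split_form_comp[OF 1(1) 1(3) 2(2)]] 1(2) 2(1) by simp
  qed
qed

text \<open>The scalings and the means determine the translations, hence the images of
  \<open>x\<close> and \<open>y\<close>, hence the automorphism.\<close>

lemma inj_on_coords: "inj_on coords (Aut_Poi_split f)"
proof (rule inj_onI)
  fix \<phi> \<psi> assume "\<phi> \<in> Aut_Poi_split f" "\<psi> \<in> Aut_Poi_split f" and eq: "coords \<phi> = coords \<psi>"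
  then show "\<phi> = \<psi>"
    by (elim Aut_Poi_splitE) (auto simp: split_form_def intro: aut_eqI)
qed

abbreviation H :: "('k \<times> 'k) monoid" where
  "H \<equiv> H_group (card S) (card T) (star_card S) (star_card T)"

lemma carrier_H_group:
  "carrier (H_group m n ms ns) = {(\<gamma>, \<delta>). \<gamma> \<noteq> 0 \<and> \<delta> \<noteq> 0 \<and>
     \<gamma> ^ ms = 1 \<and> \<delta> ^ ns = 1 \<and> \<gamma> ^ (m - 1) * \<delta> ^ (n - 1) = 1}"
  by (simp add: H_group_def)

lemma coords_in_H:
  assumes "\<phi> \<in> Aut_Poi_split f"
  shows "coords \<phi> \<in> carrier H"
  using assms
proof (rule Aut_Poi_splitE)
  fix a a'
  assume "is_poisson_aut f \<phi>" and c: "coords \<phi> = (a, a')"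
    and s: "split_form \<phi> a ((a - 1) * mean S) a' ((a' - 1) * mean T)"
  then show ?thesis
    using split_form_facts(3-5)[OF \<open>is_poisson_aut f \<phi>\<close> s]
    by (simp add: c carrier_H_group split_form_def)
qed

end

section \<open>Cardinalities\<close>

text \<open>If one of the two factors in the mixed equation is 1, so is the other; together with
  \<open>ms = m\<close> or \<open>ns = n\<close>, two consecutive powers of a coordinate are 1, so
  the coordinate is 1. If \<open>ms = m\<close> and \<open>ns = n\<close>, multiplying the mixed
  equation by both coordinates shows that their product is 1.\<close>

lemma H_group_subset:
  fixes m n ms ns :: nat
  assumes m: "m \<ge> 3" and n: "n \<ge> 3" and ms: "ms = m - 1 \<or> ms = m" and ns: "ns = n - 1 \<or> ns = n"
  defines "R \<equiv> \<lambda>k. {x::'k::field_char_0. x ^ k = 1}"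
  shows "ms = m - 1 \<Longrightarrow> ns = n - 1 \<Longrightarrow> carrier (H_group m n ms ns) \<subseteq> R (m - 1) \<times> R (n - 1)"
    and "ms = m \<Longrightarrow> ns = n - 1 \<Longrightarrow> carrier (H_group m n ms ns) \<subseteq> {1} \<times> R (n - 1)"
    and "ms = m - 1 \<Longrightarrow> ns = n \<Longrightarrow> carrier (H_group m n ms ns) \<subseteq> R (m - 1) \<times> {1}"
    and "ms = m \<Longrightarrow> ns = n \<Longrightarrow> carrier (H_group m n ms ns) \<subseteq> (\<lambda>x. (x, inverse x)) ` R m"
proof -
  have pow: "x ^ m = x * x ^ (m - 1)" "x ^ n = x * x ^ (n - 1)" for x :: 'k
    using m n by (simp_all flip: power_Suc)
  show "carrier (H_group m n ms ns) \<subseteq> R (m - 1) \<times> R (n - 1)" if "ms = m - 1" "ns = n - 1"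
    using that by (auto simp: H_group_def R_def)
  show "carrier (H_group m n ms ns) \<subseteq> {1} \<times> R (n - 1)" if "ms = m" "ns = n - 1"
    using that by (auto simp: H_group_def R_def pow)
  show "carrier (H_group m n ms ns) \<subseteq> R (m - 1) \<times> {1}" if "ms = m - 1" "ns = n"
    using that by (auto simp: H_group_def R_def pow)
  show "carrier (H_group m n ms ns) \<subseteq> (\<lambda>x. (x, inverse x)) ` R m" if eq: "ms = m" "ns = n"
  proof
    fix z :: "'k \<times> 'k" assume "z \<in> carrier (H_group m n ms ns)"
    then obtain x y where z: "z = (x, y)" and xy: "x ^ m = 1" "y ^ n = 1" "x ^ (m - 1) * y ^ (n - 1) = 1"
      using eq by (auto simp: H_group_def)
    have "x * y = (x * y) * (x ^ (m - 1) * y ^ (n - 1))"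
      by (simp only: xy(3) mult_1_right)
    also have "\<dots> = x ^ m * y ^ n"
      unfolding pow by (simp only: mult_ac)
    finally have "y = inverse x"
      by (simp add: xy inverse_unique)
    with z xy(1) show "z \<in> (\<lambda>x. (x, inverse x)) ` R m"
      by (auto simp: R_def)
  qed
qed

text \<open>Counting roots of unity in the four cases gives the bounds \<open>(m-1)(n-1)\<close>,
  \<open>n-1\<close>, \<open>m-1\<close> and \<open>m\<close>. The last one is within
  \<open>(m-1)(n-1)\<close> because \<open>m\<close> \<le> \<open>2(m-1)\<close>.\<close>

lemma card_H_group:
  fixes m n ms ns :: nat
  assumes m: "m \<ge> 3" and n: "n \<ge> 3" and ms: "ms = m - 1 \<or> ms = m" and ns: "ns = n - 1 \<or> ns = n"
  defines "K \<equiv> carrier (H_group m n ms ns :: ('k::field_char_0 \<times> 'k) monoid)"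
  shows "finite K" "card K \<le> (m - 1) * (n - 1)"
    and "ms = m \<Longrightarrow> ns = n \<Longrightarrow> card K \<le> m"
proof -
  let ?R = "\<lambda>k. {x::'k. x ^ k = 1}"
  note sub = H_group_subset[OF m n ms ns, where 'k = 'k, folded K_def]
  have fin: "finite (?R k)" and card: "card (?R k) \<le> k" if "k > 0" for k
    using finite_card_power_eq_1[OF that] by blast+
  have bound: "finite K \<and> card K \<le> l" if "K \<subseteq> L" "finite L" "card L \<le> l" for L l
    using that by (meson card_mono finite_subset order_trans)
  have diag: "finite K \<and> card K \<le> m" if "ms = m" "ns = n"
  proof (rule bound[OF sub(4)[OF that]])
    have "card ((\<lambda>x::'k. (x, inverse x)) ` ?R m) \<le> card (?R m)"
      using m by (intro card_image_le fin) simp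
    also have "\<dots> \<le> m"
      using m by (intro card) simp
    finally show "card ((\<lambda>x::'k. (x, inverse x)) ` ?R m) \<le> m" .
  qed (use m fin in simp)
  have le: "m \<le> (m - 1) * (n - 1)" "n - 1 \<le> (m - 1) * (n - 1)" "m - 1 \<le> (m - 1) * (n - 1)"
  proof -
    have "m \<le> (m - 1) * 2"
      using m by simp
    also have "\<dots> \<le> (m - 1) * (n - 1)"
      using n by (intro mult_le_mono) simp_all
    finally show "m \<le> (m - 1) * (n - 1)" .
  qed (use m n in simp_all)
  have "finite K \<and> card K \<le> (m - 1) * (n - 1)"
    using ms ns
  proof (elim disjE)
    assume "ms = m - 1" "ns = n - 1"
    from sub(1)[OF this] show ?thesis
      by (rule bound) (use m n in \<open>auto simp: card_cartesian_product intro!: finite_cartesian_product fin mult_le_mono card\<close>)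
  next
    assume "ms = m - 1" "ns = n"
    from sub(3)[OF this] show ?thesis
      by (rule bound) (use m n order_trans[OF card le(3)] in
          \<open>auto simp: card_cartesian_product intro!: finite_cartesian_product fin\<close>)
  next
    assume "ms = m" "ns = n - 1"
    from sub(2)[OF this] show ?thesis
      by (rule bound) (use m n order_trans[OF card le(2)] in
          \<open>auto simp: card_cartesian_product intro!: finite_cartesian_product fin\<close>)
  next
    assume "ms = m" "ns = n"
    from diag[OF this] le(1) show ?thesis
      by simp
  qed
  then show "finite K" "card K \<le> (m - 1) * (n - 1)"
    by auto
  show "ms = m \<Longrightarrow> ns = n \<Longrightarrow> card K \<le> m"
    using diag by blast
qed

lemma hom_inj_image:
  assumes G: "group G" and H: "group H" and h: "h \<in> hom G H" and inj: "inj_on h (carrier G)"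
  shows "subgroup (h ` carrier G) H" and "G \<cong> H\<lparr>carrier := h ` carrier G\<rparr>"
proof -
  interpret group_hom G H h
    using G H h by (simp add: group_hom_def group_hom_axioms_def)
  show "subgroup (h ` carrier G) H"
    by (rule img_is_subgroup)
  have "h \<in> iso G (H\<lparr>carrier := h ` carrier G\<rparr>)"
    using inj by (auto simp: iso_def hom_def bij_betw_def)
  then show "G \<cong> H\<lparr>carrier := h ` carrier G\<rparr>"
    by (rule is_isoI)
qed

section \<open>Structure and order of the automorphism group\<close>

context product_bracket
begin

lemma star_card_cases:
  "star_card S = card S - 1 \<or> star_card S = card S" "star_card T = card T - 1 \<or> star_card T = card T"
  by (simp_all add: star_card_eq finite_S finite_T)

lemma Aut_Poi_split_normal:
  "Aut_Poi_split f \<lhd> Aut_Poi f"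
  "finite (rcosets\<^bsub>Aut_Poi f\<^esub> Aut_Poi_split f)"
  "card (rcosets\<^bsub>Aut_Poi f\<^esub> Aut_Poi_split f) \<le> 2"
  "finite (Aut_Poi_split f) \<Longrightarrow> finite (carrier (Aut_Poi f))"
  unfolding Aut_Poi_split_eq
  by (rule group.index_two_of_parity[OF group_Aut_Poi];
      simp add: carrier_Aut_Poi mult_Aut_Poi preserves_x_comp)+

lemma group_Aut_Poi_split: "group (Aut_Poi f\<lparr>carrier := Aut_Poi_split f\<rparr>)"
  using Aut_Poi_split_normal(1) group_Aut_Poi
  by (intro group.subgroup_imp_group normal_imp_subgroup)

lemma coords_hom: "coords \<in> hom (Aut_Poi f\<lparr>carrier := Aut_Poi_split f\<rparr>) H"
proof (rule homI)
  fix \<phi> \<psi>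
  assume "\<phi> \<in> carrier (Aut_Poi f\<lparr>carrier := Aut_Poi_split f\<rparr>)"
    "\<psi> \<in> carrier (Aut_Poi f\<lparr>carrier := Aut_Poi_split f\<rparr>)"
  then show "coords (\<phi> \<otimes>\<^bsub>Aut_Poi f\<lparr>carrier := Aut_Poi_split f\<rparr>\<^esub> \<psi>)
      = coords \<phi> \<otimes>\<^bsub>H\<^esub> coords \<psi>"
    by (simp add: mult_Aut_Poi coords_comp H_group_def DirProd_def units_group_def split_beta)
qed (simp add: coords_in_H)

lemma Aut_Poi_split_finite:
  "finite (Aut_Poi_split f)" "card (Aut_Poi_split f) \<le> card (carrier H)"
proof -
  have H: "finite (carrier H)"
    by (rule card_H_group(1)[OF card_S card_T star_card_cases])
  have sub: "coords ` Aut_Poi_split f \<subseteq> carrier H"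
    using coords_in_H by blast
  show "finite (Aut_Poi_split f)"
    using finite_imageD[OF finite_subset[OF sub H] inj_on_coords] .
  show "card (Aut_Poi_split f) \<le> card (carrier H)"
    by (rule card_inj_on_le[OF inj_on_coords sub H])
qed

lemma Aut_Poi_eq_split:
  assumes "\<not> (card S = card T \<and> even (card S) \<and> star_card S = card S \<and> star_card T = card S)"
  shows "carrier (Aut_Poi f) = Aut_Poi_split f"
proof -
  have "preserves_x \<phi>" if \<phi>: "is_poisson_aut f \<phi>" for \<phi>
    using aut_cases[OF \<phi>] split_form_preserves_x swap_form_facts[OF \<phi>] assms by metis
  then show ?thesis
    by (auto simp: Aut_Poi_split_eq carrier_Aut_Poi)
qed

text \<open>Here the second coordinate in \<open>H\<close> is the inverse of the first, so the
  scaling of \<open>x\<close> alone embeds \<open>G\<close> into the units of the field.\<close>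

lemma Aut_Poi_split_cyclic:
  assumes "star_card S = card S" "star_card T = card T"
  shows "cyclic_group (Aut_Poi f\<lparr>carrier := Aut_Poi_split f\<rparr>)"
    and "card (Aut_Poi_split f) \<le> card S"
proof -
  let ?G = "Aut_Poi f\<lparr>carrier := Aut_Poi_split f\<rparr>" and ?h = "fst \<circ> coords"
  show "card (Aut_Poi_split f) \<le> card S"
    using Aut_Poi_split_finite(2)
      card_H_group(3)[OF card_S card_T star_card_cases assms] by (rule order_trans)
  have units: "group (units_group :: 'k monoid)"
    using comm_group_units_group by (rule comm_group.axioms)
  have hom: "?h \<in> hom ?G (units_group :: 'k monoid)"
  proof (rule homI)
    fix \<phi> assume "\<phi> \<in> carrier ?G"
    then show "?h \<phi> \<in> carrier units_group"
      using coords_in_H[of \<phi>] by (auto simp: H_group_def units_group_def)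
  next
    fix \<phi> \<psi> assume "\<phi> \<in> carrier ?G" "\<psi> \<in> carrier ?G"
    then show "?h (\<phi> \<otimes>\<^bsub>?G\<^esub> \<psi>) = ?h \<phi> \<otimes>\<^bsub>units_group\<^esub> ?h \<psi>"
      by (simp add: mult_Aut_Poi coords_comp units_group_def)
  qed
  have "inj_on fst (carrier H)"
    by (rule inj_on_subset[OF _ H_group_subset(4)[OF card_S card_T star_card_cases assms]])
      (auto simp: inj_on_def)
  then have "inj_on ?h (Aut_Poi_split f)"
    using coords_in_H by (intro comp_inj_on inj_on_coords) (blast intro: inj_on_subset)
  then have inj: "inj_on ?h (carrier ?G)"
    by simp
  note img = hom_inj_image[OF group_Aut_Poi_split units hom inj]
  have "cyclic_group (units_group\<lparr>carrier := ?h ` carrier ?G\<rparr>)"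
    using Aut_Poi_split_finite(1) by (intro cyclic_group_finite_subgroup_units[OF img(1)]) simp
  then show "cyclic_group ?G"
    using isomorphic_group_cyclicity[OF img(2) group_Aut_Poi_split
        group.subgroup_imp_group[OF units img(1)]] by simp
qed

lemma card_Aut_Poi:
  "finite (carrier (Aut_Poi f))" "Coset.order (Aut_Poi f) \<le> (card S - 1) * (card T - 1)"
proof -
  show "finite (carrier (Aut_Poi f))"
    by (rule Aut_Poi_split_normal(4)[OF Aut_Poi_split_finite(1)])
  show "Coset.order (Aut_Poi f) \<le> (card S - 1) * (card T - 1)"
  proof (cases "card S = card T \<and> even (card S) \<and> star_card S = card S \<and> star_card T = card S")
    case False
    have "Coset.order (Aut_Poi f) = card (Aut_Poi_split f)"
      unfolding order_def Aut_Poi_eq_split[OF False] ..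
    also have "\<dots> \<le> card (carrier H)"
      by (rule Aut_Poi_split_finite(2))
    also have "\<dots> \<le> (card S - 1) * (card T - 1)"
      by (rule card_H_group(2)[OF card_S card_T star_card_cases])
    finally show ?thesis .
  next
    case True
    \<comment> \<open>Evenness raises the bound 3 to 4, so \<open>k\<close> \<ge> \<open>2\<close>.
      Then \<open>2(k+2)\<close> \<le> \<open>(k+1)^2\<close> reduces to \<open>3\<close> \<le>
      \<open>k^2\<close>.\<close>
    define k where "k = card S - 2"
    have "card S \<noteq> 3"
      using True by auto
    then have k: "card S = k + 2" "k \<ge> 2"
      using card_S by (auto simp: k_def)
    have "Coset.order (Aut_Poi f)
        = card (rcosets\<^bsub>Aut_Poi f\<^esub> Aut_Poi_split f) * card (Aut_Poi_split f)"
      using group.lagrange[OF group_Aut_Poi normal_imp_subgroup[OF Aut_Poi_split_normal(1)]] by simp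
    also have "\<dots> \<le> 2 * (k + 2)"
      using Aut_Poi_split_normal(3) Aut_Poi_split_cyclic(2) True k(1) by (intro mult_le_mono) auto
    also have "\<dots> \<le> (k + 1) * (k + 1)"
      using mult_le_mono[OF k(2) k(2)] by simp
    also have "\<dots> = (card S - 1) * (card T - 1)"
      using True k(1) by (metis add_diff_cancel_right' add_2_eq_Suc' Suc_eq_plus1 diff_Suc_1)
    finally show ?thesis .
  qed
qed

end

theorem theorem7p5:
  fixes c :: "'k::field_char_0" and \<xi> \<chi> :: "nat \<Rightarrow> 'k" and m n ms ns :: nat
    and f :: "'k ratfun" and G :: "('k ratfun \<Rightarrow> 'k ratfun) set"
    and H :: "('k \<times> 'k) monoid"
  assumes "c \<noteq> 0" and "m \<ge> 3" and "n \<ge> 3"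
    and "inj_on \<xi> {1..m}" and "inj_on \<chi> {1..n}"
    and f: "f = rconst c * (\<Prod>i=1..m. rX + rconst (\<xi> i)) * (\<Prod>j=1..n. rY + rconst (\<chi> j))"
    and G: "G = Aut_Poi_split f"
    and ms: "ms = star_num m \<xi>" and ns: "ns = star_num n \<chi>"
    and H: "H = H_group m n ms ns"
  shows
    "(G \<lhd> Aut_Poi f \<and> finite (rcosets\<^bsub>Aut_Poi f\<^esub> G) \<and> card (rcosets\<^bsub>Aut_Poi f\<^esub> G) \<le> 2) \<and>
     (\<exists>S. subgroup S H \<and> (Aut_Poi f)\<lparr>carrier := G\<rparr> \<cong> H\<lparr>carrier := S\<rparr>) \<and>
     (\<not> (m = n \<and> even m \<and> ms = m \<and> ns = m) \<longrightarrow> carrier (Aut_Poi f) = G) \<and>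
     (m = n \<and> even m \<and> ms = m \<and> ns = m \<longrightarrow>
        cyclic_group ((Aut_Poi f)\<lparr>carrier := G\<rparr>) \<and> finite G \<and> card G \<le> m) \<and>
     (finite (carrier (Aut_Poi f)) \<and> order (Aut_Poi f) \<le> (m - 1) * (n - 1))"
proof -
  define S T where "S = \<xi> ` {1..m}" and "T = \<chi> ` {1..n}"
  have card: "card S = m" "card T = n"
    using card_image[OF assms(4)] card_image[OF assms(5)] by (simp_all add: S_def T_def)
  have star: "star_card S = ms" "star_card T = ns"
    using star_num_eq[OF assms(4)] star_num_eq[OF assms(5)] assms(2,3) ms ns
    by (simp_all add: S_def T_def)
  have fS: "f = rconst c * (\<Prod>s\<in>S. rX + rconst s) * (\<Prod>t\<in>T. rY + rconst t)"
    unfolding f S_def T_def prod.reindex[OF assms(4)] prod.reindex[OF assms(5)] by simp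
  interpret product_bracket c S T f
    by unfold_locales (use assms(1-3) card fS in simp_all)
  note coords = hom_inj_image[OF group_Aut_Poi_split group_H_group coords_hom, simplified,
      OF inj_on_coords, folded G, unfolded card star, folded H]
  show ?thesis
    using Aut_Poi_split_normal(1-3) coords Aut_Poi_eq_split Aut_Poi_split_cyclic
      Aut_Poi_split_finite(1) card_Aut_Poi
    unfolding G[symmetric] card star by blast
qed

end
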